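(* Let $d\ge 1$ and $a<b$ be fixed, and let $V\in S(1)$ be a function of $x\in\mathbb{R}^d$ which is $(b-a)$-periodic in each coordinate. For each positive integer $N$, let $A=A_N$ and $B=B_N$ be the finite difference discretizations of $-\frac12\Delta$ and of multiplication by $V(x)$ with periodic boundary conditions on $[a,b]^d$, using $N$ grid points per dimension. Then there is a constant $C$, independent of $N$ and $\Delta t$, such that for all $N$ and all $\Delta t$ with $1/N\le \Delta t\le 1$, $$\sup_{s,\tau\in[-\Delta t,\Delta t]}\left\|\left[\left[B,\,e^{i\tau A}Be^{-i\tau A}\right],\,e^{isA}Be^{-isA}\right]\right\|\le C\,\Delta t^2 ,$$ where $\|\cdot\|$ denotes the matrix operator (spectral) norm.
   Context: $V\in S(1)$ means that $V$ is smooth and $V$ together with each of its partial derivatives of every order is bounded on $\mathbb{R}^d$ (the bound may depend on the order). $[X,Y]=XY-YX$. Discretization: the grid points in one dimension are $x_j=a+(b-a)j/N$, $0\le j\le N-1$. In dimension one, $A=\tilde A_{\mathrm{dis}}$ is the $N\times N$ matrix acting on vectors $f=(f_0,\dots,f_{N-1})$ (indices modulo $N$) by $$(\tilde A_{\mathrm{dis}}f)_j=\frac{N^2}{2(b-a)^2}\left(2f_j-f_{j+1}-f_{j-1}\right),$$ and $B=\mathrm{diag}(V(x_0),\dots,V(x_{N-1}))$. In dimension $d$, with $I_N$ the $N\times N$ identity, $$A=\tilde A_{\mathrm{dis}}\otimes I_N^{\otimes (d-1)}+I_N\otimes\tilde A_{\mathrm{dis}}\otimes I_N^{\otimes(d-2)}+\dots+I_N^{\otimes(d-1)}\otimes\tilde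 A_{\mathrm{dis}},$$ and $B$ is the $N^d\times N^d$ diagonal matrix with entries $V(x_{j_1},\dots,x_{j_d})$. The quantities $d,a,b,V$ are fixed and $C$ may depend on them. *)

theory Defs
  imports
    "HOL-Analysis.Analysis"
    "Jordan_Normal_Form.Matrix"
begin

text \<open>
  Functions on \<open>\<real>\<^sup>d\<close> live on the Cartesian type \<^typ>\<open>real ^ 'd\<close>; the matrices, whose size varies
  with the number \<open>N\<close> of grid points, are matrices of the \<^theory>\<open>Jordan_Normal_Form.Matrix\<close> library.
\<close>

no_notation Matrix.vec_index (infixl "$" 100)
no_notation Matrix.scalar_prod (infix "\<bullet>" 70)

subsection \<open>The symbol class \<open>S(1)\<close>\<close>

definition partial_deriv :: "'d::finite \<Rightarrow> (real ^ 'd \<Rightarrow> complex) \<Rightarrow> real ^ 'd \<Rightarrow> complex" where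
  "partial_deriv k f x = vector_derivative (\<lambda>t. f (x + t *\<^sub>R axis k 1)) (at 0)"

fun iter_partial :: "'d::finite list \<Rightarrow> (real ^ 'd \<Rightarrow> complex) \<Rightarrow> real ^ 'd \<Rightarrow> complex" where
  "iter_partial [] f = f"
| "iter_partial (k # ks) f = partial_deriv k (iter_partial ks f)"

text \<open>Total differentiability of all iterated partials makes them all continuous, so this is
  the usual \<open>C\<^sup>\<infinity>\<close>.\<close>

definition smooth :: "(real ^ 'd::finite \<Rightarrow> complex) \<Rightarrow> bool" where
  "smooth f \<longleftrightarrow> (\<forall>ks x. iter_partial ks f differentiable (at x))"

definition S1 :: "(real ^ 'd::finite \<Rightarrow> complex) set" where
  "S1 = {f. smooth f \<and> (\<forall>ks. bounded (range (iter_partial ks f)))}"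

definition coord_periodic :: "real \<Rightarrow> (real ^ 'd::finite \<Rightarrow> complex) \<Rightarrow> bool" where
  "coord_periodic L f \<longleftrightarrow> (\<forall>x k. f (x + L *\<^sub>R axis k 1) = f x)"

subsection \<open>Matrices\<close>

text \<open>Kronecker product; the left factor carries the most significant part of the index.\<close>

definition kron :: "complex mat \<Rightarrow> complex mat \<Rightarrow> complex mat" where
  "kron X Y = mat (dim_row X * dim_row Y) (dim_col X * dim_col Y)
     (\<lambda>(i, j). X $$ (i div dim_row Y, j div dim_col Y) * Y $$ (i mod dim_row Y, j mod dim_col Y))"

fun kron_pow :: "complex mat \<Rightarrow> nat \<Rightarrow> complex mat" where
  "kron_pow X 0 = 1\<^sub>m 1"
| "kron_pow X (Suc k) = kron X (kron_pow X k)"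

definition commutator :: "complex mat \<Rightarrow> complex mat \<Rightarrow> complex mat" where
  "commutator X Y = X * Y - Y * X"

text \<open>Entrywise exponential series, for square matrices.\<close>

definition mat_exp :: "complex mat \<Rightarrow> complex mat" where
  "mat_exp X = mat (dim_row X) (dim_row X) (\<lambda>(i, j). \<Sum>k. (X ^\<^sub>m k) $$ (i, j) / fact k)"

definition vec_norm2 :: "complex Matrix.vec \<Rightarrow> real" where
  "vec_norm2 v = sqrt (\<Sum>i<dim_vec v. (cmod (vec_index v i))\<^sup>2)"

definition op_norm :: "complex mat \<Rightarrow> real" where
  "op_norm X = (SUP v\<in>{v \<in> carrier_vec (dim_col X). vec_norm2 v \<le> 1}. vec_norm2 (X *\<^sub>v v))"

text \<open>\<open>e\<^bsup>itA\<^esup> B e\<^bsup>-itA\<^esup>\<close>\<close>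

definition conj_evol :: "complex mat \<Rightarrow> complex mat \<Rightarrow> real \<Rightarrow> complex mat" where
  "conj_evol A B t = mat_exp ((\<i> * of_real t) \<cdot>\<^sub>m A) * B * mat_exp ((- \<i> * of_real t) \<cdot>\<^sub>m A)"

subsection \<open>The finite difference discretization\<close>

text \<open>The \<open>of_bool\<close> terms are added rather than case-split because the neighbours \<open>j \<plusminus> 1\<close>
  coincide modulo \<open>N\<close> when \<open>N \<le> 2\<close>.\<close>

definition lap1 :: "real \<Rightarrow> real \<Rightarrow> nat \<Rightarrow> complex mat" where
  "lap1 a b N = mat N N (\<lambda>(j, l). of_real ((real N)\<^sup>2 / (2 * (b - a)\<^sup>2)) *
     (2 * of_bool (l = j) - of_bool (l = (j + 1) mod N) - of_bool (l = (j + N - 1) mod N)))"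

definition discA :: "nat \<Rightarrow> real \<Rightarrow> real \<Rightarrow> nat \<Rightarrow> complex mat" where
  "discA d a b N = mat (N ^ d) (N ^ d) (\<lambda>ij. \<Sum>k<d.
     kron (kron (kron_pow (1\<^sub>m N) k) (lap1 a b N)) (kron_pow (1\<^sub>m N) (d - 1 - k)) $$ ij)"

definition grid :: "real \<Rightarrow> real \<Rightarrow> nat \<Rightarrow> nat \<Rightarrow> real" where
  "grid a b N j = a + (b - a) * real j / real N"

text \<open>The row index \<open>i < N ^ d\<close> of a \<open>d\<close>-fold Kronecker product stands for the digits
  \<open>(j\<^sub>0, \<dots>, j\<^sub>d\<^sub>-\<^sub>1)\<close> of \<open>i\<close> in base \<open>N\<close>, most significant first.\<close>

definition multi_index :: "nat \<Rightarrow> nat \<Rightarrow> nat \<Rightarrow> nat \<Rightarrow> nat" where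
  "multi_index d N i k = (i div N ^ (d - 1 - k)) mod N"

text \<open>The index type \<open>'d\<close> carries no order, so a numbering \<open>pos\<close> of the coordinates by
  \<open>0, \<dots>, d - 1\<close> tells which tensor factor a coordinate belongs to.\<close>

definition grid_point :: "('d::finite \<Rightarrow> nat) \<Rightarrow> real \<Rightarrow> real \<Rightarrow> nat \<Rightarrow> nat \<Rightarrow> real ^ 'd" where
  "grid_point pos a b N i = (\<chi> c. grid a b N (multi_index CARD('d) N i (pos c)))"

definition discB ::
  "('d::finite \<Rightarrow> nat) \<Rightarrow> (real ^ 'd \<Rightarrow> complex) \<Rightarrow> real \<Rightarrow> real \<Rightarrow> nat \<Rightarrow> complex mat" where
  "discB pos V a b N = mat_diag (N ^ CARD('d)) (\<lambda>i. V (grid_point pos a b N i))"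

end

theory Submission
  imports Defs "HOL-Library.Function_Algebras"
begin

text \<open>
  The Fourier modes \<open>\<chi>\<^sub>p\<close> of the grid diagonalize \<open>A\<close>, with eigenvalues \<open>\<lambda>(p)\<close>, and multiplication by
  \<open>\<chi>\<^sub>k\<close> shifts \<open>\<chi>\<^sub>p\<close> to \<open>\<chi>\<^sub>p\<^sub>+\<^sub>k\<close>. Expanding \<open>V\<close> on the grid into its discrete Fourier modes with coefficients
  \<open>w\<^sub>k\<close>, the nested commutator therefore maps \<open>\<chi>\<^sub>p\<close> to a sum over frequencies \<open>k, l, m\<close> of
  \<open>w\<^sub>k w\<^sub>l w\<^sub>m c(p) \<chi>\<^sub>p\<^sub>+\<^sub>k\<^sub>+\<^sub>l\<^sub>+\<^sub>m\<close>, where \<open>c\<close> is a combination of phases \<open>exp (i t (\<lambda>(p + k) - \<lambda>(p)))\<close>.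
  Since second differences of \<open>\<lambda>\<close> are bounded and third differences are \<open>O(1/N) = O(\<Delta>t)\<close>, one gets
  \<open>c = O(\<Delta>t\<^sup>2)\<close> up to polynomial factors in \<open>k, l, m\<close>. These are absorbed by the decay of \<open>w\<close>, which is
  uniform in \<open>N\<close> by summation by parts, and Parseval's identity converts the bounds into operator norms.
\<close>

subsection \<open>Finite differences of symbols in \<open>S(1)\<close>\<close>

text \<open>\<open>A\<close> has norm of order N^2 and [A, B] can reach order N, so for \<Delta>t
  \<ge> 1/N the exponentials cannot be expanded in \<Delta>t: a single phase t (\<lambda>(p + k) -
  \<lambda>(p)) may be as large as \<Delta>t N. What is small is the change of a phase with the base
  frequency p, and each commutator takes one such difference. The inner one produces a second
  difference of \<lambda>, hence one factor \<Delta>t. The outer one either differences once more,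
  giving \<Delta>t/N and thus calling for 1/N \<le> \<Delta>t, or gives a product of two changes of
  phase. The frequencies of V are integer vectors near 0 and not residues, since both the difference
  bounds and the decay refer to the actual size of k. The base frequency may leave its cube freely,
  because modes and eigenvalues are periodic modulo N. The exponents balance:
  \<open>comm_coeff\<close> costs the square of each weight, the coefficients of V decay like the
  inverse fourth power, and the remaining inverse squares are summable in every dimension because
  the weight is a product over the coordinates.\<close>

lemma iter_partial_append: "iter_partial (ks @ js) f = iter_partial ks (iter_partial js f)"
  by (induction ks) auto

lemma S1_iter_partial:
  assumes "f \<in> S1" shows "iter_partial js f \<in> S1"
  using assms unfolding S1_def smooth_def by (simp flip: iter_partial_append)

lemma S1_partial_deriv:
  assumes "f \<in> S1" shows "partial_deriv c f \<in> S1"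
  using S1_iter_partial[OF assms, of "[c]"] by simp

lemma S1_bounded:
  assumes "f \<in> S1" obtains C where "\<And>x. norm (f x) \<le> C" "C \<ge> 0"
proof -
  have "bounded (range (iter_partial [] f))" using assms unfolding S1_def by blast
  then obtain C where "\<And>x. norm (f x) \<le> C" by (auto simp: bounded_iff)
  then show ?thesis by (meson norm_ge_zero order_trans that)
qed

lemma S1_differentiable:
  assumes "f \<in> S1" shows "f differentiable (at x)"
proof -
  have "iter_partial [] f differentiable (at x)" using assms unfolding S1_def smooth_def by blast
  then show ?thesis by simp
qed

definition fdiff :: "'d::finite \<Rightarrow> real \<Rightarrow> (real ^ 'd \<Rightarrow> complex) \<Rightarrow> real ^ 'd \<Rightarrow> complex" where
  "fdiff c h f x = f (x + h *\<^sub>R axis c 1) - f x"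

lemma has_vector_derivative_line:
  fixes f :: "real ^ 'd::finite \<Rightarrow> complex"
  assumes "f differentiable (at (x + t *\<^sub>R axis c 1))"
  shows "((\<lambda>t. f (x + t *\<^sub>R axis c 1)) has_vector_derivative partial_deriv c f (x + t *\<^sub>R axis c 1)) (at t)"
proof -
  let ?g = "\<lambda>t. f (x + t *\<^sub>R axis c 1)"
  have "?g differentiable (at t)"
    using assms by (intro differentiable_chain_at[of "\<lambda>t. x + t *\<^sub>R axis c 1" t f, unfolded o_def] derivative_intros) auto
  then obtain D where D: "(?g has_vector_derivative D) (at t)"
    by (auto simp: vector_derivative_works)
  \<comment> \<open>\<open>partial_deriv\<close> differentiates at parameter 0, so the line is
    reparametrized to start at \<open>t\<close>.\<close>
  have "((?g \<circ> (\<lambda>s. t + s)) has_vector_derivative (1 *\<^sub>R D)) (at 0)"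
    by (rule vector_diff_chain_at) (auto intro!: derivative_eq_intros simp: D)
  then have "partial_deriv c f (x + t *\<^sub>R axis c 1) = D"
    unfolding partial_deriv_def by (intro vector_derivative_at) (simp add: o_def algebra_simps)
  with D show ?thesis by simp
qed

lemma fdiff_bound:
  fixes f :: "real ^ 'd::finite \<Rightarrow> complex"
  assumes diff: "\<And>x. f differentiable (at x)" and bd: "\<And>x. norm (partial_deriv c f x) \<le> C"
  shows "norm (fdiff c h f x) \<le> C * \<bar>h\<bar>"
proof -
  have "norm ((\<lambda>t. f (x + t *\<^sub>R axis c 1)) h - (\<lambda>t. f (x + t *\<^sub>R axis c 1)) 0) \<le> C * norm (h - 0)"
  proof (rule differentiable_bound[where S = UNIV])
    fix t :: real
    show "((\<lambda>t. f (x + t *\<^sub>R axis c 1)) has_derivative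
        (\<lambda>s. s *\<^sub>R partial_deriv c f (x + t *\<^sub>R axis c 1))) (at t within UNIV)"
      using has_vector_derivative_line[OF diff] by (simp add: has_vector_derivative_def)
    show "onorm (\<lambda>s. s *\<^sub>R partial_deriv c f (x + t *\<^sub>R axis c 1)) \<le> C"
      by (intro onorm_le) (simp add: mult.commute[of C] mult_left_mono bd)
  qed auto
  then show ?thesis by (simp add: fdiff_def)
qed

lemma fdiff_differentiable:
  assumes "\<And>x. f differentiable (at x)"
  shows "fdiff c h f differentiable (at x)"
proof -
  have "(\<lambda>x. f (x + h *\<^sub>R axis c 1)) differentiable (at x)"
    using assms by (intro differentiable_chain_at[of "\<lambda>x. x + h *\<^sub>R axis c 1" x f, unfolded o_def] derivative_intros) auto
  then show ?thesis unfolding fdiff_def[abs_def] using assms by (intro derivative_intros) auto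
qed

lemma partial_deriv_fdiff:
  assumes "\<And>x. f differentiable (at x)"
  shows "partial_deriv k (fdiff c h f) = fdiff c h (partial_deriv k f)"
proof
  fix x
  have *: "((\<lambda>t. f (y + t *\<^sub>R axis k 1)) has_vector_derivative partial_deriv k f y) (at 0)" for y
    using has_vector_derivative_line[OF assms, where t = 0 and x = y] by simp
  have "((\<lambda>t. fdiff c h f (x + t *\<^sub>R axis k 1)) has_vector_derivative
      partial_deriv k f (x + h *\<^sub>R axis c 1) - partial_deriv k f x) (at 0)"
    unfolding fdiff_def using has_vector_derivative_diff[OF *[of "x + h *\<^sub>R axis c 1"] *[of x]]
    by (simp add: add_ac)
  then show "partial_deriv k (fdiff c h f) x = fdiff c h (partial_deriv k f) x"
    by (simp add: partial_deriv_def fdiff_def vector_derivative_at)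
qed

text \<open>The identity minus a rescaled second difference. Its Fourier multiplier is at least
  \<open>1 + 4 k\<^sub>c\<^sup>2\<close> when \<open>2 \<bar>k\<^sub>c\<bar> \<le> N\<close>, so two applications per coordinate give decay of order \<open>weight k ^ (- 4)\<close>.\<close>

definition stencil :: "real \<Rightarrow> nat \<Rightarrow> 'd::finite \<Rightarrow> (real ^ 'd \<Rightarrow> complex) \<Rightarrow> real ^ 'd \<Rightarrow> complex" where
  "stencil L N c f x = f x + (of_nat N)\<^sup>2 * fdiff c (L / real N) (fdiff c (- L / real N) f) x"

lemma stencil_differentiable:
  assumes "\<And>x. f differentiable (at x)"
  shows "stencil L N c f differentiable (at x)"
  unfolding stencil_def[abs_def] by (intro derivative_intros fdiff_differentiable assms)

lemma partial_deriv_add_scaled: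
  assumes "\<And>x. f differentiable (at x)" "\<And>x. g differentiable (at x)"
  shows "partial_deriv k (\<lambda>x. f x + u * g x) = (\<lambda>x. partial_deriv k f x + u * partial_deriv k g x)"
proof
  fix x
  have *: "((\<lambda>t. h (x + t *\<^sub>R axis k 1)) has_vector_derivative partial_deriv k h x) (at 0)"
    if "\<And>x. h differentiable (at x)" for h
    using has_vector_derivative_line[OF that, where t = 0 and x = x] by simp
  show "partial_deriv k (\<lambda>x. f x + u * g x) x = partial_deriv k f x + u * partial_deriv k g x"
    unfolding partial_deriv_def[of k "\<lambda>x. f x + u * g x"]
    by (intro vector_derivative_at has_vector_derivative_add has_vector_derivative_mult_right * assms)
qed

lemma partial_deriv_stencil:
  assumes "\<And>x. f differentiable (at x)"
  shows "partial_deriv k (stencil L N c f) = stencil L N c (partial_deriv k f)"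
  unfolding stencil_def[abs_def]
  by (simp add: partial_deriv_add_scaled partial_deriv_fdiff fdiff_differentiable assms)

lemma foldr_stencil_differentiable:
  assumes "\<And>x. f differentiable (at x)"
  shows "foldr (stencil L N) cs f differentiable (at x)"
  by (induction cs arbitrary: x) (auto intro: assms stencil_differentiable)

lemma partial_deriv_foldr_stencil:
  assumes "\<And>x. f differentiable (at x)"
  shows "partial_deriv k (foldr (stencil L N) cs f) = foldr (stencil L N) cs (partial_deriv k f)"
  by (induction cs) (auto simp: partial_deriv_stencil foldr_stencil_differentiable assms)

text \<open>Stencils commute with partial derivatives, so the induction ranges over all of
  \<open>S1\<close>: the outermost stencil is controlled by the inner ones applied to
  \<open>f\<close> and to its second partial derivative in direction \<open>c\<close>.\<close>

lemma foldr_stencil_bounded: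
  fixes f :: "real ^ 'd::finite \<Rightarrow> complex"
  assumes "f \<in> S1"
  shows "\<exists>C. \<forall>N x. N \<ge> 1 \<longrightarrow> norm (foldr (stencil L N) cs f x) \<le> C"
  using assms
proof (induction cs arbitrary: f)
  case Nil
  then obtain C where "\<And>x. norm (f x) \<le> C" by (rule S1_bounded) blast
  then show ?case by auto
next
  case (Cons c cs)
  define f2 where "f2 = partial_deriv c (partial_deriv c f)"
  have f1: "partial_deriv c f \<in> S1" and f2: "f2 \<in> S1"
    using Cons.prems by (auto simp: f2_def intro!: S1_partial_deriv)
  obtain C where C: "\<And>N x. N \<ge> 1 \<Longrightarrow> norm (foldr (stencil L N) cs f x) \<le> C"
    using Cons.IH[OF Cons.prems] by blast
  obtain C2 where C2: "\<And>N x. N \<ge> 1 \<Longrightarrow> norm (foldr (stencil L N) cs f2 x) \<le> C2"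
    using Cons.IH[OF f2] by blast
  have "norm (foldr (stencil L N) (c # cs) f x) \<le> C + C2 * L\<^sup>2" if N: "N \<ge> 1" for N x
  proof -
    define g where "g = foldr (stencil L N) cs f"
    have gd: "g differentiable (at x)" for x
      unfolding g_def using S1_differentiable[OF Cons.prems] by (rule foldr_stencil_differentiable)
    have g1: "partial_deriv c g = foldr (stencil L N) cs (partial_deriv c f)"
      unfolding g_def by (rule partial_deriv_foldr_stencil) (rule S1_differentiable[OF Cons.prems])
    have g1d: "partial_deriv c g differentiable (at x)" for x
      unfolding g1 using S1_differentiable[OF f1] by (rule foldr_stencil_differentiable)
    have g2: "partial_deriv c (partial_deriv c g) = foldr (stencil L N) cs f2"
      unfolding g1 f2_def by (rule partial_deriv_foldr_stencil) (rule S1_differentiable[OF f1])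
    \<comment> \<open>The mean value inequality is used once per difference; each use gains a factor
      \<open>\<bar>L\<bar> / N\<close>, and together they cancel the \<open>N\<^sup>2\<close> of the
      stencil.\<close>
    have "norm (partial_deriv c (fdiff c (- L / real N) g) x) \<le> C2 * \<bar>- L / real N\<bar>" for x
      unfolding partial_deriv_fdiff[OF gd] using g1d by (rule fdiff_bound) (simp only: g2 C2[OF N])
    then have "norm (fdiff c (L / real N) (fdiff c (- L / real N) g) x) \<le> C2 * \<bar>- L / real N\<bar> * \<bar>L / real N\<bar>"
      by (intro fdiff_bound fdiff_differentiable gd)
    then have "(real N)\<^sup>2 * norm (fdiff c (L / real N) (fdiff c (- L / real N) g) x)
        \<le> (real N)\<^sup>2 * (C2 * \<bar>- L / real N\<bar> * \<bar>L / real N\<bar>)"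
      by (intro mult_left_mono) auto
    also have "\<dots> = C2 * L\<^sup>2" using N by (simp add: field_simps power2_eq_square flip: abs_mult)
    finally have "(real N)\<^sup>2 * norm (fdiff c (L / real N) (fdiff c (- L / real N) g) x) \<le> C2 * L\<^sup>2" .
    then have "norm (stencil L N c g x) \<le> norm (g x) + C2 * L\<^sup>2"
      unfolding stencil_def by (intro order_trans[OF norm_triangle_ineq]) (simp add: norm_mult norm_power)
    then show ?thesis using C[OF N, of x] by (simp add: g_def)
  qed
  then show ?case by blast
qed

subsection \<open>The discrete Fourier transform on the grid\<close>

text \<open>Frequencies and grid indices share one type, which makes \<open>wave\<close> symmetric;
  every orthogonality relation over positions is then also one over frequencies.\<close>

definition wave :: "nat \<Rightarrow> ('d::finite \<Rightarrow> int) \<Rightarrow> ('d \<Rightarrow> int) \<Rightarrow> complex" where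
  "wave N p j = cis (2 * pi * real_of_int (\<Sum>c\<in>UNIV. p c * j c) / real N)"

text \<open>The corner \<open>u\<close> is kept free: 0 for grid indices, about -N/2 for the
  frequencies of V.\<close>

definition cube :: "int \<Rightarrow> nat \<Rightarrow> ('d::finite \<Rightarrow> int) set" where
  "cube u N = {j. \<forall>c. u \<le> j c \<and> j c < u + int N}"

lemma cube_PiE: "cube u N = PiE UNIV (\<lambda>_. {u..<u + int N})"
  by (auto simp: cube_def PiE_def Pi_def)

lemma finite_cube [simp]: "finite (cube u N :: ('d::finite \<Rightarrow> int) set)"
  by (simp add: cube_PiE finite_PiE)

lemma card_cube: "card (cube u N :: ('d::finite \<Rightarrow> int) set) = N ^ CARD('d)"
  by (simp add: cube_PiE card_PiE)

lemma wave_add_left: "wave N (p + q) j = wave N p j * wave N q j"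
  by (simp add: wave_def cis_mult sum.distrib ring_distribs add_divide_distrib)

lemma wave_commute: "wave N p j = wave N j p"
  by (simp add: wave_def mult.commute)

lemma wave_add_right: "wave N p (j + k) = wave N p j * wave N p k"
  by (metis wave_add_left wave_commute)

lemma wave_minus_left: "wave N (- p) j = cnj (wave N p j)"
  by (simp add: wave_def cis_cnj sum_negf)

lemma norm_wave [simp]: "norm (wave N p j) = 1"
  by (simp add: wave_def)

lemma cis_of_int_multiple: "cis (2 * pi * real_of_int m) = 1"
  by (rule cis_multiple_2pi) simp

lemma cis_sum: "cis (\<Sum>c\<in>S. g c) = (\<Prod>c\<in>S. cis (g c))"
  by (induction S rule: infinite_finite_induct) (auto simp: cis_mult[symmetric])

lemma wave_prod: "wave N p j = (\<Prod>c\<in>UNIV. cis (2 * pi * real_of_int (p c * j c) / real N))"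
  unfolding cis_sum[symmetric] by (simp add: wave_def sum_distrib_left sum_divide_distrib)

lemma cis_div_mod:
  assumes "N \<ge> 1"
  shows "cis (2 * pi * real_of_int ((m mod int N) * l) / real N) = cis (2 * pi * real_of_int (m * l) / real N)"
proof -
  have "m * l = (int N * (m div int N) + m mod int N) * l" by simp
  then have "m * l = (m mod int N) * l + int N * (m div int N * l)"
    by (simp only: ring_distribs mult_ac add_ac)
  then have "real_of_int (m * l) = real_of_int ((m mod int N) * l) + real N * real_of_int (m div int N * l)"
    by (metis of_int_add of_int_mult of_int_of_nat_eq)
  then have "2 * pi * real_of_int (m * l) / real N =
      2 * pi * real_of_int ((m mod int N) * l) / real N + 2 * pi * real_of_int (m div int N * l)"
    using assms by (simp only: ring_distribs add_divide_distrib) simp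
  then show ?thesis by (simp only: cis_mult[symmetric] cis_of_int_multiple mult_1_right)
qed

lemma wave_mod_left: "N \<ge> 1 \<Longrightarrow> wave N (\<lambda>c. p c mod int N) j = wave N p j"
  unfolding wave_prod by (intro prod.cong refl cis_div_mod)

lemma wave_mod_right: "N \<ge> 1 \<Longrightarrow> wave N p (\<lambda>c. j c mod int N) = wave N p j"
  by (metis wave_mod_left wave_commute)

text \<open>A geometric series whose ratio is an \<open>N\<close>-th root of unity, equal to 1
  exactly when \<open>N\<close> divides \<open>m\<close>. The left endpoint \<open>u\<close>
  contributes only a common factor.\<close>

lemma sum_cis_interval:
  assumes N: "N \<ge> 1"
  shows "(\<Sum>l\<in>{u..<u + int N}. cis (2 * pi * real_of_int (m * l) / real N)) =
    of_nat N * of_bool (int N dvd m)"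
proof -
  define z where "z = cis (2 * pi * real_of_int m / real N)"
  have "(\<Sum>l\<in>{u..<u + int N}. cis (2 * pi * real_of_int (m * l) / real N)) =
      (\<Sum>i<N. cis (2 * pi * real_of_int (m * (u + int i)) / real N))"
    by (rule sum.reindex_bij_witness[of _ "\<lambda>i. u + int i" "\<lambda>l. nat (l - u)"]) auto
  also have "\<dots> = (\<Sum>i<N. cis (2 * pi * real_of_int (m * u) / real N) * z ^ i)"
  proof (intro sum.cong refl)
    fix i
    have "2 * pi * real_of_int (m * (u + int i)) / real N =
        2 * pi * real_of_int (m * u) / real N + real i * (2 * pi * real_of_int m / real N)"
      by (simp add: ring_distribs add_divide_distrib)
    then show "cis (2 * pi * real_of_int (m * (u + int i)) / real N) =
        cis (2 * pi * real_of_int (m * u) / real N) * z ^ i"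
      by (simp only: z_def cis_mult[symmetric] Complex.DeMoivre[symmetric])
  qed
  also have "\<dots> = cis (2 * pi * real_of_int (m * u) / real N) * (\<Sum>i<N. z ^ i)"
    by (simp add: sum_distrib_left)
  finally have *: "(\<Sum>l\<in>{u..<u + int N}. cis (2 * pi * real_of_int (m * l) / real N)) =
    cis (2 * pi * real_of_int (m * u) / real N) * (\<Sum>i<N. z ^ i)" .
  show ?thesis
  proof (cases "int N dvd m")
    case True
    then obtain r where r: "m = int N * r" by (auto elim: dvdE)
    have "2 * pi * real_of_int m / real N = 2 * pi * real_of_int r" using N by (simp add: r)
    then have "z = 1" by (simp only: z_def cis_of_int_multiple)
    moreover have "2 * pi * real_of_int (m * u) / real N = 2 * pi * real_of_int (r * u)"
      using N by (simp add: r)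
    then have "cis (2 * pi * real_of_int (m * u) / real N) = 1"
      by (simp only: cis_of_int_multiple)
    ultimately show ?thesis using True * by simp
  next
    case False
    have "z \<noteq> 1"
    proof
      assume "z = 1"
      then have "cos (2 * pi * real_of_int m / real N) = 1"
        by (simp add: z_def complex_eq_iff)
      then obtain r :: int where "2 * pi * real_of_int m / real N = real_of_int r * 2 * pi"
        by (auto simp only: cos_one_2pi_int)
      then have "real_of_int m = real_of_int (int N * r)"
        using N by (simp add: field_simps)
      then have "m = int N * r" by linarith
      with False show False by simp
    qed
    moreover have "real N * (2 * pi * real_of_int m / real N) = 2 * pi * real_of_int m"
      using N by simp
    then have "z ^ N = 1"
      by (simp only: z_def Complex.DeMoivre cis_of_int_multiple)
    ultimately have "(\<Sum>i<N. z ^ i) = 0" by (simp add: sum_gp_strict)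
    with False * show ?thesis by simp
  qed
qed

lemma sum_wave_cube:
  fixes p :: "'d::finite \<Rightarrow> int"
  assumes "N \<ge> 1"
  shows "(\<Sum>j\<in>cube u N. wave N p j) = of_nat (N ^ CARD('d)) * of_bool (\<forall>c. int N dvd p c)"
proof -
  have "(\<Sum>j\<in>cube u N. wave N p j) =
      (\<Prod>c\<in>UNIV. \<Sum>l\<in>{u..<u + int N}. cis (2 * pi * real_of_int (p c * l) / real N))"
    unfolding cube_PiE by (subst prod_sum_PiE) (auto simp: wave_prod)
  also have "\<dots> = (\<Prod>c\<in>UNIV. of_nat N * of_bool (int N dvd p c))"
    using assms by (simp only: sum_cis_interval)
  also have "\<dots> = of_nat (N ^ CARD('d)) * (\<Prod>c\<in>(UNIV::'d set). of_bool (int N dvd p c))"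
    by (simp add: prod.distrib)
  also have "(\<Prod>c\<in>(UNIV::'d set). of_bool (int N dvd p c)) = (of_bool (\<forall>c. int N dvd p c) :: complex)"
    by (cases "\<forall>c. int N dvd p c") (auto simp: prod_zero_iff)
  finally show ?thesis .
qed

lemma cube_eq_iff_dvd:
  assumes "p \<in> cube u N" "q \<in> cube u N"
  shows "(\<forall>c. int N dvd (p - q) c) \<longleftrightarrow> p = q"
proof
  assume *: "\<forall>c. int N dvd (p - q) c"
  show "p = q"
  proof
    fix c
    have "\<bar>p c - q c\<bar> < int N" 
    proof -
      have "u \<le> p c \<and> p c < u + int N" "u \<le> q c \<and> q c < u + int N" using assms by (auto simp: cube_def)
      then show ?thesis by linarith
    qed
    moreover have "int N dvd p c - q c" using * by simp
    ultimately show "p c = q c" using dvd_imp_le_int[of "p c - q c" "int N"] by auto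
  qed
qed auto

lemma sum_wave_diff:
  fixes p q :: "'d::finite \<Rightarrow> int"
  assumes "N \<ge> 1" "p \<in> cube w N" "q \<in> cube w N"
  shows "(\<Sum>j\<in>cube u N. wave N p j * cnj (wave N q j)) = of_nat (N ^ CARD('d)) * of_bool (p = q)"
proof -
  have "(\<Sum>j\<in>cube u N. wave N p j * cnj (wave N q j)) = (\<Sum>j\<in>cube u N. wave N (p - q) j)"
    by (simp flip: wave_minus_left wave_add_left)
  then show ?thesis using assms by (simp only: sum_wave_cube cube_eq_iff_dvd)
qed

text \<open>Translation by \<open>k\<close> followed by reduction modulo \<open>N\<close> permutes
  the cube.\<close>

lemma sum_cube_periodic_shift:
  fixes F :: "('d::finite \<Rightarrow> int) \<Rightarrow> 'b::comm_monoid_add"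
  assumes N: "N \<ge> 1" and per: "\<And>j. F (\<lambda>c. j c mod int N) = F j"
  shows "(\<Sum>j\<in>cube 0 N. F (j + k)) = (\<Sum>j\<in>cube 0 N. F j)"
proof (rule sum.reindex_bij_witness[of _ "\<lambda>j c. (j c - k c) mod int N" "\<lambda>j c. (j c + k c) mod int N"])
  fix j :: "'d \<Rightarrow> int" assume j: "j \<in> cube 0 N"
  have *: "j c mod int N = j c" for c using j N by (auto simp: cube_def)
  show "(\<lambda>c. ((j c + k c) mod int N - k c) mod int N) = j"
    by (simp add: fun_eq_iff mod_diff_left_eq *)
  show "(\<lambda>c. ((j c - k c) mod int N + k c) mod int N) = j"
    by (simp add: fun_eq_iff mod_add_left_eq *)
  show "(\<lambda>c. (j c + k c) mod int N) \<in> cube 0 N" "(\<lambda>c. (j c - k c) mod int N) \<in> cube 0 N"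
    using N by (auto simp: cube_def)
  show "F (\<lambda>c. (j c + k c) mod int N) = F (j + k)"
    using per[of "j + k"] by simp
qed

text \<open>The whole normalization sits in the forward transform: inversion carries no factor, and
  a sup bound on \<open>f\<close> is a bound on its coefficients with the same constant.\<close>

definition dft :: "nat \<Rightarrow> (('d::finite \<Rightarrow> int) \<Rightarrow> complex) \<Rightarrow> ('d \<Rightarrow> int) \<Rightarrow> complex" where
  "dft N f k = (\<Sum>j\<in>cube 0 N. cnj (wave N k j) * f j) / of_nat (N ^ CARD('d))"

lemma dft_add: "dft N (\<lambda>j. f j + g j) k = dft N f k + dft N g k"
  by (simp add: dft_def ring_distribs sum.distrib add_divide_distrib)

lemma dft_diff: "dft N (\<lambda>j. f j - g j) k = dft N f k - dft N g k"
  by (simp add: dft_def right_diff_distrib sum_subtractf diff_divide_distrib)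

lemma dft_scale: "dft N (\<lambda>j. u * f j) k = u * dft N f k"
  by (simp add: dft_def mult.left_commute[of _ u] flip: sum_distrib_left)

text \<open>By the symmetry of \<open>wave\<close>, the sum over frequencies is again an
  orthogonality sum, valid over any translate of the cube. This permits frequencies centred at
  0.\<close>

lemma dft_inversion:
  fixes f :: "('d::finite \<Rightarrow> int) \<Rightarrow> complex"
  assumes N: "N \<ge> 1" and j: "j \<in> cube 0 N"
  shows "(\<Sum>k\<in>cube u N. dft N f k * wave N k j) = f j"
proof -
  have "(\<Sum>k\<in>cube u N. dft N f k * wave N k j) =
      (\<Sum>k\<in>cube u N. \<Sum>i\<in>cube 0 N. f i * (wave N j k * cnj (wave N i k)) / of_nat (N ^ CARD('d)))"
    unfolding dft_def sum_divide_distrib sum_distrib_right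
  proof (intro sum.cong refl)
    fix k i :: "'d \<Rightarrow> int"
    have "wave N j k = wave N k j" "wave N i k = wave N k i" by (rule wave_commute)+
    then show "cnj (wave N k i) * f i / of_nat (N ^ CARD('d)) * wave N k j =
      f i * (wave N j k * cnj (wave N i k)) / of_nat (N ^ CARD('d))" by simp
  qed
  also have "\<dots> = (\<Sum>i\<in>cube 0 N. f i * (\<Sum>k\<in>cube u N. wave N j k * cnj (wave N i k)) / of_nat (N ^ CARD('d)))"
    by (subst sum.swap) (simp add: sum_distrib_left sum_divide_distrib)
  also have "\<dots> = (\<Sum>i\<in>cube 0 N. if i = j then f j else 0)"
    using N j by (intro sum.cong refl) (auto simp: sum_wave_diff)
  also have "\<dots> = f j" using j by simp
  finally show ?thesis .
qed

lemma dft_shift: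
  fixes f :: "('d::finite \<Rightarrow> int) \<Rightarrow> complex"
  assumes N: "N \<ge> 1" and per: "\<And>j. f (\<lambda>c. j c mod int N) = f j"
  shows "dft N (\<lambda>j. f (j + e)) k = wave N k e * dft N f k"
proof -
  have *: "cnj (wave N k j) = wave N k e * cnj (wave N k (j + e))" for j
  proof -
    have "wave N k e * cnj (wave N k e) = 1" by (simp add: complex_norm_square[symmetric])
    then show ?thesis by (simp add: wave_add_right algebra_simps)
  qed
  have "(\<Sum>j\<in>cube 0 N. cnj (wave N k j) * f (j + e)) =
      wave N k e * (\<Sum>j\<in>cube 0 N. cnj (wave N k (j + e)) * f (j + e))"
    unfolding sum_distrib_left by (intro sum.cong refl) (subst *, simp add: mult_ac)
  also have "(\<Sum>j\<in>cube 0 N. cnj (wave N k (j + e)) * f (j + e)) = (\<Sum>j\<in>cube 0 N. cnj (wave N k j) * f j)"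
    by (rule sum_cube_periodic_shift[OF N]) (simp add: per wave_mod_right[OF N])
  finally show ?thesis by (simp only: dft_def times_divide_eq_right)
qed

lemma norm_dft_le:
  fixes f :: "('d::finite \<Rightarrow> int) \<Rightarrow> complex"
  assumes N: "N \<ge> 1" and bd: "\<And>j. norm (f j) \<le> C"
  shows "norm (dft N f k) \<le> C"
proof -
  have "norm (\<Sum>j\<in>cube 0 N. cnj (wave N k j) * f j) \<le> (\<Sum>j\<in>(cube 0 N :: ('d \<Rightarrow> int) set). C)"
    by (intro order_trans[OF norm_sum] sum_mono) (simp add: norm_mult bd)
  also have "\<dots> = real (N ^ CARD('d)) * C" by (simp add: card_cube)
  finally show ?thesis using N by (simp add: dft_def norm_divide norm_power field_simps)
qed

subsection \<open>Decay of the discrete Fourier coefficients\<close>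

lemma coord_periodic_int:
  assumes "coord_periodic L f"
  shows "f (x + (L * of_int m) *\<^sub>R axis c 1) = f x"
proof -
  have nat: "f (x + (L * of_nat n) *\<^sub>R axis c 1) = f x" for n x
  proof (induction n)
    case (Suc n)
    have "x + (L * of_nat (Suc n)) *\<^sub>R axis c 1 = (x + (L * of_nat n) *\<^sub>R axis c 1) + L *\<^sub>R axis c 1"
      by (simp add: algebra_simps)
    then show ?case using assms Suc unfolding coord_periodic_def by metis
  qed simp
  show ?thesis
  proof (cases "m \<ge> 0")
    case True
    then show ?thesis using nat[of x "nat m"] by simp
  next
    case False
    then show ?thesis using nat[of "x + (L * of_int m) *\<^sub>R axis c 1" "nat (- m)"] by simp
  qed
qed

lemma coord_periodic_lattice:
  fixes f :: "real ^ 'd::finite \<Rightarrow> complex"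
  assumes "coord_periodic L f"
  shows "f (x + (\<chi> c. L * of_int (m c))) = f x"
proof -
  have "f (x + (\<Sum>c\<in>S. (L * of_int (m c)) *\<^sub>R axis c 1)) = f x" if "finite S" for S
    using that
  proof (induction S)
    case (insert c S)
    then show ?case
      using coord_periodic_int[OF assms, of "x + (\<Sum>c\<in>S. (L * of_int (m c)) *\<^sub>R axis c 1)" "m c" c]
      by (simp add: add_ac)
  qed simp
  moreover have "(\<chi> c. L * of_int (m c)) = (\<Sum>c\<in>UNIV. (L * of_int (m c)) *\<^sub>R axis c 1)"
    using basis_expansion[of "\<chi> c. L * of_int (m c)"] by (simp add: scalar_mult_eq_scaleR)
  ultimately show ?thesis by simp
qed

text \<open>Grid points with arbitrary integer indices, so that index shifts need no wrap-around;
  periodic functions see only the residues of the indices.\<close>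

definition node :: "real \<Rightarrow> real \<Rightarrow> nat \<Rightarrow> ('d::finite \<Rightarrow> int) \<Rightarrow> real ^ 'd" where
  "node a L N j = (\<chi> c. a + L * of_int (j c) / real N)"

lemma node_mod:
  assumes "coord_periodic L f" "N \<ge> 1"
  shows "f (node a L N (\<lambda>c. j c mod int N)) = f (node a L N j)"
proof -
  have "a + L * of_int (j c) / real N = a + L * of_int (j c mod int N) / real N + L * of_int (j c div int N)" for c
  proof -
    have "real_of_int (j c) = real_of_int (int N * (j c div int N) + j c mod int N)" by simp
    also have "\<dots> = real N * of_int (j c div int N) + of_int (j c mod int N)" by (simp only: of_int_add of_int_mult of_int_of_nat_eq)
    finally show ?thesis using assms(2) by (simp add: ring_distribs add_divide_distrib)
  qed
  then have "node a L N j = node a L N (\<lambda>c. j c mod int N) + (\<chi> c. L * of_int (j c div int N))"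
    by (simp add: node_def Finite_Cartesian_Product.vec_eq_iff)
  then show ?thesis using coord_periodic_lattice[OF assms(1)] by metis
qed

lemma coord_periodic_stencil:
  assumes "coord_periodic L f"
  shows "coord_periodic L (stencil M N c f)"
proof -
  have *: "f (y + L *\<^sub>R axis k 1) = f y" for y k using assms by (simp add: coord_periodic_def)
  have "f (x + L *\<^sub>R axis k 1 + u + v) = f (x + u + v)" "f (x + L *\<^sub>R axis k 1 + u) = f (x + u)"
    "f (x + L *\<^sub>R axis k 1 - u) = f (x - u)" for x k u v
    using *[of "x + u + v" k] *[of "x + u" k] *[of "x - u" k] by (simp_all add: algebra_simps)
  then show ?thesis by (simp add: coord_periodic_def stencil_def fdiff_def *)
qed

section \<open>The Fourier multiplier of the rescaled second difference\<close>

definition symbol :: "nat \<Rightarrow> int \<Rightarrow> real" where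
  "symbol N m = (real N)\<^sup>2 * (2 - 2 * cos (2 * pi * real_of_int m / real N))"

lemma two_minus_cis: "2 - cis x - cnj (cis x) = of_real (2 - 2 * cos x)"
  by (simp add: complex_eq_iff)

definition unit_step :: "'d::finite \<Rightarrow> 'd \<Rightarrow> int" where
  "unit_step c = (\<lambda>i. of_bool (i = c))"

lemma wave_unit_step: "wave N k (unit_step c) = cis (2 * pi * real_of_int (k c) / real N)"
  by (simp add: wave_def unit_step_def sum.delta' if_distrib of_bool_def cong: if_cong)

text \<open>The two nested differences equal 2 f(x) - f(x + h) - f(x - h) with h = L/N. On the grid
  these are unit index shifts, so the transform turns them into 2 - 2 cos; this is the discrete form
  of integrating by parts twice.\<close>

lemma dft_stencil:
  fixes f :: "real ^ 'd::finite \<Rightarrow> complex"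
  assumes per: "coord_periodic L f" and N: "N \<ge> 1"
  shows "dft N (\<lambda>j. stencil L N c f (node a L N j)) k =
    of_real (1 + symbol N (k c)) * dft N (\<lambda>j. f (node a L N j)) k"
proof -
  define F where "F = (\<lambda>j. f (node a L N j))"
  define e :: "'d \<Rightarrow> int" where "e = unit_step c"
  have Fper: "F (\<lambda>c. j c mod int N) = F j" for j
    unfolding F_def by (rule node_mod[OF per N])
  have step: "node a L N j + (L / real N) *\<^sub>R axis c 1 = node a L N (j + e)" for j
    by (auto simp: node_def Finite_Cartesian_Product.vec_eq_iff axis_def e_def unit_step_def ring_distribs add_divide_distrib)
  have step': "node a L N j + (- L / real N) *\<^sub>R axis c 1 = node a L N (j - e)" for j
    using step[of "j - e"] by (simp add: algebra_simps)
  have "stencil L N c f (node a L N j) = F j + (of_nat N)\<^sup>2 * (2 * F j - F (j + e) - F (j + (- e)))" for j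
    unfolding stencil_def fdiff_def step step' F_def by (simp add: algebra_simps)
  then have "dft N (\<lambda>j. stencil L N c f (node a L N j)) k =
      dft N F k + (of_nat N)\<^sup>2 * (2 * dft N F k - dft N (\<lambda>j. F (j + e)) k - dft N (\<lambda>j. F (j + (- e))) k)"
    by (simp only: dft_add dft_diff dft_scale)
  also have "\<dots> = dft N F k + (of_nat N)\<^sup>2 * (2 - wave N k e - cnj (wave N k e)) * dft N F k"
    unfolding dft_shift[of N F, OF N Fper] wave_commute[of N k] wave_minus_left by (simp add: algebra_simps)
  also have "\<dots> = of_real (1 + symbol N (k c)) * dft N F k"
    unfolding e_def wave_unit_step two_minus_cis symbol_def by (simp add: algebra_simps)
  finally show ?thesis by (simp only: F_def)
qed

lemma foldr_stencil_periodic: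
  "coord_periodic L f \<Longrightarrow> coord_periodic L (foldr (stencil M N) cs f)"
  by (induction cs) (auto intro: coord_periodic_stencil)

lemma dft_foldr_stencil:
  fixes f :: "real ^ 'd::finite \<Rightarrow> complex"
  assumes per: "coord_periodic L f" and N: "N \<ge> 1"
  shows "dft N (\<lambda>j. foldr (stencil L N) cs f (node a L N j)) k =
    of_real (\<Prod>c\<leftarrow>cs. 1 + symbol N (k c)) * dft N (\<lambda>j. f (node a L N j)) k"
  by (induction cs) (simp_all add: dft_stencil[OF foldr_stencil_periodic[OF per] N])

text \<open>For y^2 \<le> 4 the cubic Taylor remainder is at most two thirds of
  \<open>\<bar>y\<bar>\<close>. The range 2 is chosen to contain the interval up to pi/2.\<close>

lemma abs_sin_ge:
  fixes y :: real
  assumes "\<bar>y\<bar> \<le> 2" shows "\<bar>sin y\<bar> \<ge> \<bar>y\<bar> / 3"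
proof -
  have "\<bar>sin y - (\<Sum>m<3. sin_coeff m * y ^ m)\<bar> \<le> inverse (fact 3) * \<bar>y\<bar> ^ 3"
    by (rule Maclaurin_sin_bound)
  then have "\<bar>sin y - y\<bar> \<le> \<bar>y\<bar> ^ 3 / 6"
    by (simp add: eval_nat_numeral sin_coeff_def)
  moreover have "\<bar>y\<bar> ^ 3 \<le> 4 * \<bar>y\<bar>"
    using mult_mono[OF assms assms] by (simp add: power3_eq_cube mult_right_mono)
  ultimately show ?thesis by linarith
qed

text \<open>With y = pi m / N one has 2 - 2 cos(2 y) = 4 sin(y)^2, and frequencies up to N/2 keep y
  within pi/2. Larger frequencies must be excluded because \<open>symbol\<close> is periodic in
  \<open>m\<close>.\<close>

lemma symbol_ge:
  assumes "2 * \<bar>m\<bar> \<le> int N"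
  shows "symbol N m \<ge> 4 * (real_of_int m)\<^sup>2"
proof (cases "N = 0")
  case False
  define y where "y = pi * real_of_int m / real N"
  have "2 * \<bar>real_of_int m\<bar> \<le> real N" using assms by linarith
  then have "\<bar>y\<bar> \<le> pi / 2"
    using False by (simp add: y_def abs_mult field_simps)
  then have "\<bar>y\<bar> \<le> 2" using pi_less_4 by linarith
  then have "(\<bar>y\<bar> / 3)\<^sup>2 \<le> \<bar>sin y\<bar>\<^sup>2" by (intro power_mono abs_sin_ge) auto
  then have "y\<^sup>2 / 9 \<le> (sin y)\<^sup>2" by (simp add: power_divide)
  have "2 - 2 * cos (2 * pi * real_of_int m / real N) = 4 * (sin y)\<^sup>2"
    using cos_double_sin[of y] by (simp add: y_def mult.assoc)
  then have "symbol N m = 4 * (real N)\<^sup>2 * (sin y)\<^sup>2" by (simp add: symbol_def)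
  also have "\<dots> \<ge> 4 * (real N)\<^sup>2 * (y\<^sup>2 / 9)"
    by (intro mult_left_mono) (use \<open>y\<^sup>2 / 9 \<le> (sin y)\<^sup>2\<close> in auto)
  also have "4 * (real N)\<^sup>2 * (y\<^sup>2 / 9) = 4 * (pi / 3)\<^sup>2 * (real_of_int m)\<^sup>2"
    using False by (simp add: y_def power_divide power_mult_distrib)
  \<comment> \<open>The estimate pi > 3 absorbs the factor 3 lost in
    \<open>abs_sin_ge\<close>.\<close>
  also have "\<dots> \<ge> 4 * 1 * (real_of_int m)\<^sup>2"
    using pi_gt3 by (intro mult_left_mono mult_right_mono) auto
  finally show ?thesis by simp
qed (use assms in \<open>simp add: symbol_def\<close>)

text \<open>A product over coordinates rather than a norm: sums of its powers factor into
  one-dimensional series, so the summable exponent does not depend on the dimension.\<close>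

definition weight :: "('d::finite \<Rightarrow> int) \<Rightarrow> real" where
  "weight k = (\<Prod>c\<in>UNIV. 1 + \<bar>real_of_int (k c)\<bar>)"

lemma weight_ge_1: "weight k \<ge> 1"
  unfolding weight_def by (rule prod_ge_1) simp

lemma weight_nonneg [simp]: "weight k \<ge> 0"
  using weight_ge_1[of k] by linarith

lemma abs_le_weight: "\<bar>real_of_int (k c)\<bar> \<le> weight k"
proof -
  have "weight k = (1 + \<bar>real_of_int (k c)\<bar>) * (\<Prod>c\<in>UNIV - {c}. 1 + \<bar>real_of_int (k c)\<bar>)"
    unfolding weight_def by (rule prod.remove) auto
  also have "\<dots> \<ge> (1 + \<bar>real_of_int (k c)\<bar>) * 1"
    by (intro mult_left_mono prod_ge_1) auto
  finally show ?thesis by simp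
qed

definition centred_cube :: "nat \<Rightarrow> ('d::finite \<Rightarrow> int) set" where
  "centred_cube N = cube (- int (N div 2)) N"

lemma centred_cubeD: "k \<in> centred_cube N \<Longrightarrow> 2 * \<bar>k c\<bar> \<le> int N"
proof -
  assume "k \<in> centred_cube N"
  then have "- int (N div 2) \<le> k c \<and> k c < - int (N div 2) + int N"
    by (simp add: centred_cube_def cube_def)
  then show ?thesis by linarith
qed

text \<open>Multiplying a coefficient by the stencil multiplier gives a coefficient of a function
  bounded uniformly in \<open>N\<close>; the decay is the reciprocal of that multiplier.\<close>

lemma dft_decay:
  fixes f :: "real ^ 'd::finite \<Rightarrow> complex"
  assumes "f \<in> S1" and per: "coord_periodic L f"
  shows "\<exists>C\<ge>0. \<forall>N. \<forall>k\<in>centred_cube N. N \<ge> 1 \<longrightarrow>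
    norm (dft N (\<lambda>j. f (node a L N j)) k) \<le> C / weight k ^ 4"
proof -
  obtain xs :: "'d list" where xs: "set xs = UNIV" "distinct xs"
    using finite_distinct_list[OF finite] by blast
  \<comment> \<open>Every coordinate is listed twice, so its multiplier enters squared, which yields
    the exponent 4.\<close>
  obtain C where C: "\<And>N x. N \<ge> 1 \<Longrightarrow> norm (foldr (stencil L N) (xs @ xs) f x) \<le> C"
    using foldr_stencil_bounded[OF assms(1)] by blast
  have "0 \<le> C" using C[of 1 0] norm_ge_zero order_trans by blast
  moreover have "norm (dft N (\<lambda>j. f (node a L N j)) k) \<le> C / weight k ^ 4"
    if k: "k \<in> centred_cube N" and N: "N \<ge> 1" for N k
  proof -
    define S where "S = (\<Prod>c\<leftarrow>xs @ xs. 1 + symbol N (k c))"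
    have "S = (\<Prod>c\<in>UNIV. (1 + symbol N (k c))\<^sup>2)"
      using xs by (simp add: S_def prod.distinct_set_conv_list[symmetric] power2_eq_square prod.distrib)
    also have "\<dots> \<ge> (\<Prod>c\<in>UNIV. (1 + \<bar>real_of_int (k c)\<bar>) ^ 4)"
    proof (intro prod_mono conjI)
      fix c
      \<comment> \<open>Integrality of \<open>k c\<close> enters here; it gives (1 + x)^2 \<le> 1 +
        3 x^2 for x the absolute value of \<open>k c\<close>.\<close>
      have "\<bar>real_of_int (k c)\<bar> \<le> \<bar>real_of_int (k c)\<bar>\<^sup>2"
      proof (cases "k c = 0")
        case False
        then have "1 \<le> \<bar>real_of_int (k c)\<bar>" by linarith
        then show ?thesis by (rule self_le_power) simp
      qed simp
      then have "(1 + \<bar>real_of_int (k c)\<bar>)\<^sup>2 \<le> 1 + symbol N (k c)"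
        using symbol_ge[OF centred_cubeD[OF k], of c] by (simp add: power2_sum)
      then have "((1 + \<bar>real_of_int (k c)\<bar>)\<^sup>2)\<^sup>2 \<le> (1 + symbol N (k c))\<^sup>2"
        by (intro power_mono) auto
      then show "(1 + \<bar>real_of_int (k c)\<bar>) ^ 4 \<le> (1 + symbol N (k c))\<^sup>2" by simp
    qed simp
    finally have S: "weight k ^ 4 \<le> S" by (simp add: weight_def prod_power_distrib)
    have "norm (of_real S * dft N (\<lambda>j. f (node a L N j)) k) \<le> C"
      unfolding S_def dft_foldr_stencil[OF per N, symmetric] by (intro norm_dft_le N C)
    then have "\<bar>S\<bar> * norm (dft N (\<lambda>j. f (node a L N j)) k) \<le> C" by (simp add: norm_mult)
    moreover have "weight k ^ 4 * norm (dft N (\<lambda>j. f (node a L N j)) k) \<le> \<bar>S\<bar> * norm (dft N (\<lambda>j. f (node a L N j)) k)"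
      using S by (intro mult_right_mono) auto
    ultimately show ?thesis
      using weight_ge_1[of k] by (simp add: field_simps)
  qed
  ultimately show ?thesis by blast
qed

text \<open>Each absolute value is taken by at most two integers, whence the factor 2, uniformly in
  the endpoints.\<close>

lemma sum_abs_interval_bounded:
  fixes g :: "nat \<Rightarrow> real"
  assumes "summable g" "\<And>n. g n \<ge> 0"
  shows "(\<Sum>m\<in>{u..<v}. g (nat \<bar>m\<bar>)) \<le> 2 * suminf g"
proof -
  have sub: "{u..<v} \<subseteq> int ` {..nat \<bar>v\<bar>} \<union> (\<lambda>n. - int n) ` {..nat \<bar>u\<bar>}"
  proof
    fix m assume m: "m \<in> {u..<v}"
    show "m \<in> int ` {..nat \<bar>v\<bar>} \<union> (\<lambda>n. - int n) ` {..nat \<bar>u\<bar>}"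
    proof (cases "m \<ge> 0")
      case True
      then show ?thesis using m by (intro UnI1 image_eqI[of _ _ "nat m"]) auto
    next
      case False
      then show ?thesis using m by (intro UnI2 image_eqI[of _ _ "nat (- m)"]) auto
    qed
  qed
  have "(\<Sum>m\<in>{u..<v}. g (nat \<bar>m\<bar>)) \<le> (\<Sum>m\<in>int ` {..nat \<bar>v\<bar>} \<union> (\<lambda>n. - int n) ` {..nat \<bar>u\<bar>}. g (nat \<bar>m\<bar>))"
    by (intro sum_mono2 sub) (auto simp: assms(2))
  also have "\<dots> \<le> (\<Sum>m\<in>int ` {..nat \<bar>v\<bar>}. g (nat \<bar>m\<bar>)) + (\<Sum>m\<in>(\<lambda>n. - int n) ` {..nat \<bar>u\<bar>}. g (nat \<bar>m\<bar>))"
    by (subst sum_Un) (auto intro!: sum_nonneg assms(2))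
  also have "\<dots> = sum g {..nat \<bar>v\<bar>} + sum g {..nat \<bar>u\<bar>}"
    by (simp add: sum.reindex inj_on_def o_def)
  also have "\<dots> \<le> suminf g + suminf g"
    by (intro add_mono sum_le_suminf assms) (auto simp: assms)
  finally show ?thesis by simp
qed

lemma sum_inverse_weight_bounded:
  "\<exists>C\<ge>0. \<forall>N. (\<Sum>k\<in>(centred_cube N :: ('d::finite \<Rightarrow> int) set). 1 / (weight k)\<^sup>2) \<le> C"
proof -
  define g :: "nat \<Rightarrow> real" where "g n = 1 / (1 + real n)\<^sup>2" for n
  have "summable (\<lambda>n. inverse ((real (Suc n))\<^sup>2))"
    using inverse_power_summable[of 2, where 'a = real] by (subst summable_Suc_iff) auto
  then have g: "summable g" by (simp add: g_def[abs_def] field_simps)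
  have g0: "g n \<ge> 0" for n by (simp add: g_def)
  have "(\<Sum>k\<in>(centred_cube N :: ('d \<Rightarrow> int) set). 1 / (weight k)\<^sup>2) \<le> (2 * suminf g) ^ CARD('d)" for N
  proof -
    let ?I = "{- int (N div 2)..<- int (N div 2) + int N}"
    have "(\<Sum>k\<in>(centred_cube N :: ('d \<Rightarrow> int) set). 1 / (weight k)\<^sup>2) = (\<Sum>k\<in>(centred_cube N :: ('d \<Rightarrow> int) set). \<Prod>c\<in>UNIV. g (nat \<bar>k c\<bar>))"
      by (intro sum.cong refl) (simp add: g_def weight_def prod_dividef prod_power_distrib)
    also have "\<dots> = (\<Prod>c\<in>(UNIV :: 'd set). \<Sum>m\<in>?I. g (nat \<bar>m\<bar>))"
      unfolding centred_cube_def cube_PiE by (subst prod_sum_PiE) auto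
    also have "\<dots> \<le> (\<Prod>c\<in>(UNIV :: 'd set). 2 * suminf g)"
      by (intro prod_mono conjI sum_nonneg sum_abs_interval_bounded g g0)
    finally show ?thesis by simp
  qed
  moreover have "0 \<le> (2 * suminf g) ^ CARD('d)" using suminf_nonneg[OF g g0] by simp
  ultimately show ?thesis by blast
qed

subsection \<open>Fourier modes as eigenvectors of the discrete Laplacian\<close>

lemma nat_digits_inj:
  fixes m m' :: nat
  assumes "m < N ^ n" "m' < N ^ n" "\<And>t. t < n \<Longrightarrow> m div N ^ t mod N = m' div N ^ t mod N"
  shows "m = m'"
  using assms
proof (induction n arbitrary: m m')
  case (Suc n)
  have "m div N = m' div N"
  proof (rule Suc.IH)
    show "m div N < N ^ n" "m' div N < N ^ n"
      using Suc.prems by (auto simp: less_mult_imp_div_less mult.commute)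
    show "m div N div N ^ t mod N = m' div N div N ^ t mod N" if "t < n" for t
      using Suc.prems(3)[of "Suc t"] that by (simp add: div_mult2_eq)
  qed
  moreover have "m mod N = m' mod N" using Suc.prems(3)[of 0] by simp
  ultimately show ?case by (metis div_mult_mod_eq)
qed simp

lemma digit_mod_power:
  fixes i :: nat
  assumes "t < e"
  shows "i mod N ^ e div N ^ t mod N = i div N ^ t mod N"
proof (cases "N = 0")
  case False
  have "N ^ e = N ^ t * N ^ (e - t)" using assms by (simp flip: power_add)
  then have "i mod N ^ e div N ^ t = i div N ^ t mod N ^ (e - t)"
    using False by (simp add: mod_mult2_eq)
  moreover have "N dvd N ^ (e - t)" using assms by (simp add: dvd_power)
  ultimately show ?thesis by (simp add: mod_mod_cancel)
qed (use assms in \<open>cases t, auto simp: power_0_left\<close>)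

lemma digit_div_power:
  fixes i :: nat
  shows "i div N ^ e div N ^ t mod N = i div N ^ (e + t) mod N"
  by (simp add: div_mult2_eq power_add)

text \<open>The left side is the form in which Kronecker indexing presents the condition, as the
  part above digit \<open>e\<close> and the part below it; the right side is what can be read off
  coordinatewise.\<close>

lemma digits_agree_except_iff:
  fixes i j :: nat
  assumes "i < N ^ d" "j < N ^ d" "e < d"
  shows "(i div N ^ e div N = j div N ^ e div N \<and> i mod N ^ e = j mod N ^ e) \<longleftrightarrow>
    (\<forall>t<d. t \<noteq> e \<longrightarrow> i div N ^ t mod N = j div N ^ t mod N)"
    (is "?L \<longleftrightarrow> ?R")
proof
  assume L: ?L
  have "i div N ^ t mod N = j div N ^ t mod N" if "t \<noteq> e" for t
  proof (cases "t < e")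
    case True
    then show ?thesis using L digit_mod_power[OF True, of i N] digit_mod_power[OF True, of j N] by simp
  next
    case False
    then have t: "t = Suc e + (t - Suc e)" using that by simp
    have "x div N ^ t mod N = x div N ^ e div N div N ^ (t - Suc e) mod N" for x :: nat
      by (subst t) (simp add: power_add mult_ac flip: div_mult2_eq)
    then show ?thesis using L by simp
  qed
  then show ?R by blast
next
  assume R: ?R
  have "N > 0" using assms by (cases "N = 0") (auto simp: power_0_left split: if_splits)
  have d: "N ^ d = N ^ Suc e * N ^ (d - Suc e)" using assms(3) by (simp flip: power_add power_Suc)
  have "i div N ^ Suc e = j div N ^ Suc e"
  proof (rule nat_digits_inj)
    show "i div N ^ Suc e < N ^ (d - Suc e)" "j div N ^ Suc e < N ^ (d - Suc e)"
      using assms(1,2) unfolding d by (auto simp: less_mult_imp_div_less mult.commute)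
    show "i div N ^ Suc e div N ^ t mod N = j div N ^ Suc e div N ^ t mod N" if "t < d - Suc e" for t
      unfolding digit_div_power using R that by (intro R[rule_format]) auto
  qed
  moreover have "i mod N ^ e = j mod N ^ e"
  proof (rule nat_digits_inj)
    show "i mod N ^ e < N ^ e" "j mod N ^ e < N ^ e" using \<open>N > 0\<close> by auto
    show "i mod N ^ e div N ^ t mod N = j mod N ^ e div N ^ t mod N" if "t < e" for t
      unfolding digit_mod_power[OF that] using that assms(3) by (intro R[rule_format]) auto
  qed
  ultimately show ?L by (simp add: power_Suc2 del: power_Suc flip: div_mult2_eq)
qed

text \<open>Integer valued and indexed by coordinates, so that a row index becomes a point of
  \<open>cube 0 N\<close>.\<close>

definition digits :: "('d::finite \<Rightarrow> nat) \<Rightarrow> nat \<Rightarrow> nat \<Rightarrow> 'd \<Rightarrow> int" where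
  "digits pos N i = (\<lambda>c. int (multi_index CARD('d) N i (pos c)))"

lemma grid_point_eq_node: "grid_point pos a b N i = node a (b - a) N (digits pos N i)"
  by (simp add: grid_point_def node_def grid_def digits_def)

lemma bij_betw_digits:
  fixes pos :: "'d::finite \<Rightarrow> nat"
  assumes pos: "bij_betw pos UNIV {..<CARD('d)}" and N: "N \<ge> 1"
  shows "bij_betw (digits pos N) {..<N ^ CARD('d)} (cube 0 N)"
proof -
  have inj: "inj_on (digits pos N) {..<N ^ CARD('d)}"
  proof (rule inj_onI)
    fix i j assume ij: "i \<in> {..<N ^ CARD('d)}" "j \<in> {..<N ^ CARD('d)}"
      and eq: "digits pos N i = digits pos N j"
    show "i = j"
    proof (rule nat_digits_inj[of _ N "CARD('d)"])
      fix t assume t: "t < CARD('d)"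
      then have "CARD('d) - 1 - t \<in> pos ` UNIV" using pos by (auto simp: bij_betw_def)
      then obtain c where c: "pos c = CARD('d) - 1 - t" by auto
      then have "CARD('d) - 1 - pos c = t" using t by simp
      then show "i div N ^ t mod N = j div N ^ t mod N"
        using fun_cong[OF eq, of c] by (simp add: digits_def multi_index_def)
    qed (use ij in auto)
  qed
  have "digits pos N ` {..<N ^ CARD('d)} \<subseteq> cube 0 N"
    using N by (auto simp: digits_def multi_index_def cube_def simp flip: of_nat_mod)
  then have "digits pos N ` {..<N ^ CARD('d)} = cube 0 N"
    by (intro card_subset_eq) (simp_all add: card_image[OF inj] card_cube)
  with inj show ?thesis by (simp add: bij_betw_def)
qed

lemma digits_in_cube:
  fixes pos :: "'d::finite \<Rightarrow> nat"
  assumes "N \<ge> 1"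
  shows "digits pos N i \<in> cube 0 N"
  using assms by (auto simp: digits_def multi_index_def cube_def simp flip: of_nat_mod)

section \<open>Kronecker products with identity factors\<close>

lemma kron_one_one: "kron (1\<^sub>m m) (1\<^sub>m n) = 1\<^sub>m (m * n)"
proof (rule eq_matI)
  fix i j assume "i < dim_row (1\<^sub>m (m * n) :: complex mat)" "j < dim_col (1\<^sub>m (m * n) :: complex mat)"
  then have ij: "i < m * n" "j < m * n" by simp_all
  then have "n > 0" by (cases n) auto
  have "i div n < m" "j div n < m" using ij by (auto simp: less_mult_imp_div_less)
  moreover have "i div n = j div n \<Longrightarrow> i mod n = j mod n \<Longrightarrow> i = j" by (metis div_mult_mod_eq)
  ultimately show "kron (1\<^sub>m m) (1\<^sub>m n) $$ (i, j) = 1\<^sub>m (m * n) $$ (i, j)"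
    using ij \<open>n > 0\<close> by (auto simp: kron_def)
qed (auto simp: kron_def)

lemma kron_pow_one: "kron_pow (1\<^sub>m N) k = 1\<^sub>m (N ^ k)"
  by (induction k) (simp_all add: kron_one_one)

text \<open>An identity factor forces its digit to be unchanged, so the product couples two indices
  only along digit \<open>e\<close>. The reversal \<open>e = d - 1 - k\<close> arises because
  factors are counted from the most significant digit and powers of \<open>N\<close> from the
  least.\<close>

lemma kron_one_lap_one_entry:
  fixes X :: "complex mat"
  assumes X: "X \<in> carrier_mat N N" and k: "k < d" and ij: "i < N ^ d" "j < N ^ d" and e: "e = d - 1 - k"
  shows "kron (kron (kron_pow (1\<^sub>m N) k) X) (kron_pow (1\<^sub>m N) e) $$ (i, j) =
    of_bool (\<forall>t<d. t \<noteq> e \<longrightarrow> i div N ^ t mod N = j div N ^ t mod N) *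
    X $$ (i div N ^ e mod N, j div N ^ e mod N)"
proof -
  have N: "N > 0" using ij k by (cases "N = 0") (auto simp: power_0_left split: if_splits)
  have "d = k + 1 + e" using k e by simp
  then have d: "N ^ d = N ^ k * N * N ^ e" by (simp only: power_add power_one_right)
  have lt: "i div N ^ e < N ^ k * N" "j div N ^ e < N ^ k * N"
    using ij unfolding d by (auto simp: less_mult_imp_div_less)
  then have lt': "i div N ^ e div N < N ^ k" "j div N ^ e div N < N ^ k"
    by (auto simp: less_mult_imp_div_less)
  have "kron (kron (kron_pow (1\<^sub>m N) k) X) (kron_pow (1\<^sub>m N) e) $$ (i, j) =
    of_bool (i div N ^ e div N = j div N ^ e div N) * X $$ (i div N ^ e mod N, j div N ^ e mod N) *
    of_bool (i mod N ^ e = j mod N ^ e)"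
    using X N lt lt' ij unfolding kron_pow_one d by (simp add: kron_def)
  also have "\<dots> = of_bool (i div N ^ e div N = j div N ^ e div N \<and> i mod N ^ e = j mod N ^ e) *
    X $$ (i div N ^ e mod N, j div N ^ e mod N)"
    by simp
  finally show ?thesis using k e ij by (subst (asm) digits_agree_except_iff[of _ _ d]) auto
qed

text \<open>\<open>symbol\<close> already contains \<open>N\<^sup>2\<close>; the denominator
  combines the one half of -1/2 Delta with the squared period.\<close>

definition eigenvalue :: "real \<Rightarrow> nat \<Rightarrow> ('d::finite \<Rightarrow> int) \<Rightarrow> real" where
  "eigenvalue L N p = (\<Sum>c\<in>UNIV. symbol N (p c)) / (2 * L\<^sup>2)"

lemma lap1_eigen:
  assumes N: "N \<ge> 1" and m: "m < N"
  shows "(\<Sum>l<N. lap1 a b N $$ (m, l) * cis (2 * pi * real_of_int (q * int l) / real N)) =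
    of_real (symbol N q / (2 * (b - a)\<^sup>2)) * cis (2 * pi * real_of_int (q * int m) / real N)"
proof -
  define E where "E = (\<lambda>l. cis (2 * pi * real_of_int (l * q) / real N))"
  define z where "z = cis (2 * pi * real_of_int q / real N)"
  have red: "E (l mod int N) = E l" for l unfolding E_def by (rule cis_div_mod[OF N])
  have E1: "E (int m + 1) = E (int m) * z" 
    unfolding E_def z_def cis_mult by (simp add: ring_distribs add_divide_distrib)
  have E2: "E (int m - 1) = E (int m) * cnj z"
    unfolding E_def z_def cis_cnj cis_mult by (simp add: ring_distribs diff_divide_distrib)
  have r1: "E (int ((m + 1) mod N)) = E (int m) * z"
    using red[of "int m + 1"] E1 by (simp add: zmod_int add.commute)
  have "int ((m + N - 1) mod N) = (int m - 1) mod int N"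
    using N by (simp add: zmod_int of_nat_diff) (metis add_diff_eq diff_add_eq mod_add_self2)
  then have r2: "E (int ((m + N - 1) mod N)) = E (int m) * cnj z"
    using red[of "int m - 1"] E2 by simp
  let ?r = "of_real ((real N)\<^sup>2 / (2 * (b - a)\<^sup>2)) :: complex"
  have "(\<Sum>l<N. lap1 a b N $$ (m, l) * cis (2 * pi * real_of_int (q * int l) / real N)) =
      (\<Sum>l<N. ?r * ((if l = m then 2 * E (int l) else 0) - (if l = (m + 1) mod N then E (int l) else 0)
        - (if l = (m + N - 1) mod N then E (int l) else 0)))"
    using m by (intro sum.cong refl) (auto simp: lap1_def E_def mult.commute algebra_simps)
  also have "\<dots> = ?r * (2 * E (int m) - E (int ((m + 1) mod N)) - E (int ((m + N - 1) mod N)))"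
    using m N by (simp only: sum_distrib_left[symmetric] sum_subtractf) simp
  also have "\<dots> = ?r * ((2 - z - cnj z) * E (int m))"
    unfolding r1 r2 by (simp add: algebra_simps)
  also have "\<dots> = of_real (symbol N q / (2 * (b - a)\<^sup>2)) * E (int m)"
    unfolding z_def two_minus_cis symbol_def by simp
  finally show ?thesis by (simp add: E_def mult.commute)
qed

lemma sum_cube_line:
  fixes J :: "'d::finite \<Rightarrow> int" and g :: "('d \<Rightarrow> int) \<Rightarrow> complex"
  assumes J: "J \<in> cube 0 N"
  shows "(\<Sum>j\<in>cube 0 N. of_bool (\<forall>c. c \<noteq> c0 \<longrightarrow> J c = j c) * g j) = (\<Sum>l<N. g (J(c0 := int l)))"
proof -
  have "(\<Sum>j\<in>cube 0 N. of_bool (\<forall>c. c \<noteq> c0 \<longrightarrow> J c = j c) * g j) =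
      (\<Sum>j\<in>{j\<in>cube 0 N. \<forall>c. c \<noteq> c0 \<longrightarrow> J c = j c}. g j)"
    unfolding sum.inter_filter[OF finite_cube] by (intro sum.cong) auto
  also have "\<dots> = (\<Sum>l<N. g (J(c0 := int l)))"
  proof (rule sum.reindex_bij_witness[of _ "\<lambda>l. J(c0 := int l)" "\<lambda>j. nat (j c0)"])
    fix j assume "j \<in> {j \<in> cube 0 N. \<forall>c. c \<noteq> c0 \<longrightarrow> J c = j c}"
    then have j: "0 \<le> j c0" "j c0 < int N" "\<And>c. c \<noteq> c0 \<Longrightarrow> J c = j c" by (auto simp: cube_def)
    then show eq: "J(c0 := int (nat (j c0))) = j" by (auto simp: fun_eq_iff)
    show "nat (j c0) \<in> {..<N}" using j by auto
    show "g (J(c0 := int (nat (j c0)))) = g j" by (simp only: eq)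
  next
    fix l assume "l \<in> {..<N}"
    then show "J(c0 := int l) \<in> {j \<in> cube 0 N. \<forall>c. c \<noteq> c0 \<longrightarrow> J c = j c}"
      using J by (auto simp: cube_def)
  qed auto
  finally show ?thesis .
qed

lemma wave_update:
  "wave N p (J(c0 := x)) = cis (2 * pi * real_of_int (p c0 * x) / real N) *
    (\<Prod>c\<in>UNIV - {c0}. cis (2 * pi * real_of_int (p c * J c) / real N))"
proof -
  have "wave N p (J(c0 := x)) = (\<Prod>c\<in>insert c0 (UNIV - {c0}). cis (2 * pi * real_of_int (p c * (J(c0 := x)) c) / real N))"
    unfolding wave_prod by (simp add: insert_absorb)
  also have "\<dots> = cis (2 * pi * real_of_int (p c0 * x) / real N) *
    (\<Prod>c\<in>UNIV - {c0}. cis (2 * pi * real_of_int (p c * (J(c0 := x)) c) / real N))"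
    by (subst prod.insert) auto
  also have "(\<Prod>c\<in>UNIV - {c0}. cis (2 * pi * real_of_int (p c * (J(c0 := x)) c) / real N)) =
    (\<Prod>c\<in>UNIV - {c0}. cis (2 * pi * real_of_int (p c * J c) / real N))"
    by (intro prod.cong) auto
  finally show ?thesis .
qed

text \<open>Each tensor summand acts along a single coordinate line. On such a line the mode is a
  one-dimensional wave times a constant, and \<open>lap1_eigen\<close> applies; the eigenvalues of
  the summands add up.\<close>

lemma discA_eigen:
  fixes pos :: "'d::finite \<Rightarrow> nat" and p :: "'d \<Rightarrow> int"
  assumes pos: "bij_betw pos UNIV {..<CARD('d)}" and N: "N \<ge> 1" and i: "i < N ^ CARD('d)"
  shows "(\<Sum>j<N ^ CARD('d). discA CARD('d) a b N $$ (i, j) * wave N p (digits pos N j)) =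
    of_real (eigenvalue (b - a) N p) * wave N p (digits pos N i)"
proof -
  let ?d = "CARD('d)" and ?D = "digits pos N"
  let ?K = "\<lambda>k. kron (kron (kron_pow (1\<^sub>m N) k) (lap1 a b N)) (kron_pow (1\<^sub>m N) (?d - 1 - k))"
  have entry: "?K (pos c0) $$ (i, j) = of_bool (\<forall>c. c \<noteq> c0 \<longrightarrow> ?D i c = ?D j c) *
      lap1 a b N $$ (nat (?D i c0), nat (?D j c0))" if j: "j < N ^ ?d" for c0 j
  proof -
    have lt: "pos c < ?d" for c using pos by (auto simp: bij_betw_def)
    \<comment> \<open>Digit position \<open>d - 1 - pos c\<close> holds coordinate \<open>c\<close>;
      since \<open>pos\<close> is a bijection, quantifying over positions and over coordinates is
      the same.\<close>
    have "(\<forall>t<?d. t \<noteq> ?d - 1 - pos c0 \<longrightarrow> i div N ^ t mod N = j div N ^ t mod N) \<longleftrightarrow>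
      (\<forall>c. c \<noteq> c0 \<longrightarrow> ?D i c = ?D j c)" (is "?L \<longleftrightarrow> ?R")
    proof
      assume L: ?L
      show ?R
      proof (intro allI impI)
        fix c assume "c \<noteq> c0"
        then have "pos c \<noteq> pos c0" using pos by (auto simp: bij_betw_def inj_on_def)
        then have "?d - 1 - pos c < ?d" "?d - 1 - pos c \<noteq> ?d - 1 - pos c0" using lt[of c] lt[of c0] by auto
        then show "?D i c = ?D j c" using L by (simp add: digits_def multi_index_def)
      qed
    next
      assume R: ?R
      show ?L
      proof (intro allI impI)
        fix t assume t: "t < ?d" "t \<noteq> ?d - 1 - pos c0"
        then have "?d - 1 - t \<in> pos ` UNIV" using pos by (auto simp: bij_betw_def)
        then obtain c where c: "pos c = ?d - 1 - t" by auto
        with t have "c \<noteq> c0" "?d - 1 - pos c = t" by auto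
        then show "i div N ^ t mod N = j div N ^ t mod N"
          using R by (auto simp: digits_def multi_index_def)
      qed
    qed
    then show ?thesis
      using kron_one_lap_one_entry[of "lap1 a b N" N "pos c0" ?d i j, OF _ lt i j refl]
      by (simp add: lap1_def digits_def multi_index_def)
  qed
  have row: "(\<Sum>j<N ^ ?d. ?K (pos c0) $$ (i, j) * wave N p (?D j)) =
      of_real (symbol N (p c0) / (2 * (b - a)\<^sup>2)) * wave N p (?D i)" for c0
  proof -
    define R where "R = (\<Prod>c\<in>UNIV - {c0}. cis (2 * pi * real_of_int (p c * ?D i c) / real N))"
    have Di: "0 \<le> ?D i c0" "?D i c0 < int N" using digits_in_cube[OF N, of pos i] by (auto simp: cube_def)
    have "(\<Sum>j<N ^ ?d. ?K (pos c0) $$ (i, j) * wave N p (?D j)) =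
        (\<Sum>j<N ^ ?d. of_bool (\<forall>c. c \<noteq> c0 \<longrightarrow> ?D i c = ?D j c) *
          (lap1 a b N $$ (nat (?D i c0), nat (?D j c0)) * wave N p (?D j)))"
      by (intro sum.cong refl) (simp only: entry lessThan_iff mult.assoc)
    also have "\<dots> = (\<Sum>j\<in>cube 0 N. of_bool (\<forall>c. c \<noteq> c0 \<longrightarrow> ?D i c = j c) *
          (lap1 a b N $$ (nat (?D i c0), nat (j c0)) * wave N p j))"
      by (rule sum.reindex_bij_betw[OF bij_betw_digits[OF pos N]])
    also have "\<dots> = (\<Sum>l<N. lap1 a b N $$ (nat (?D i c0), l) * wave N p ((?D i)(c0 := int l)))"
      by (subst sum_cube_line[OF digits_in_cube[OF N]]) simp
    also have "\<dots> = (\<Sum>l<N. lap1 a b N $$ (nat (?D i c0), l) * cis (2 * pi * real_of_int (p c0 * int l) / real N)) * R"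
      unfolding wave_update R_def sum_distrib_right by (simp only: mult.assoc)
    also have "\<dots> = of_real (symbol N (p c0) / (2 * (b - a)\<^sup>2)) *
        (cis (2 * pi * real_of_int (p c0 * int (nat (?D i c0))) / real N) * R)"
      using Di by (subst lap1_eigen[OF N]) auto
    also have "cis (2 * pi * real_of_int (p c0 * int (nat (?D i c0))) / real N) * R = wave N p ((?D i)(c0 := ?D i c0))"
      using Di unfolding wave_update R_def by simp
    finally show ?thesis by simp
  qed
  have "(\<Sum>j<N ^ ?d. discA ?d a b N $$ (i, j) * wave N p (?D j)) =
      (\<Sum>j<N ^ ?d. \<Sum>k<?d. ?K k $$ (i, j) * wave N p (?D j))"
    using i by (intro sum.cong refl) (simp add: discA_def sum_distrib_right)
  also have "\<dots> = (\<Sum>k<?d. \<Sum>j<N ^ ?d. ?K k $$ (i, j) * wave N p (?D j))" by (rule sum.swap)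
  also have "\<dots> = (\<Sum>c0\<in>UNIV. \<Sum>j<N ^ ?d. ?K (pos c0) $$ (i, j) * wave N p (?D j))"
    by (rule sum.reindex_bij_betw[OF pos, symmetric])
  also have "\<dots> = of_real (eigenvalue (b - a) N p) * wave N p (?D i)"
    unfolding row eigenvalue_def by (simp add: sum_distrib_right sum_divide_distrib)
  finally show ?thesis .
qed

subsection \<open>Matrices in the basis of Fourier modes\<close>

text \<open>Acts on functions of all natural numbers, so modes can be used without fixing a
  dimension; only indices below the number of columns matter.\<close>

definition apply_mat :: "complex mat \<Rightarrow> (nat \<Rightarrow> complex) \<Rightarrow> nat \<Rightarrow> complex" where
  "apply_mat M u i = (\<Sum>j<dim_col M. M $$ (i, j) * u j)"

lemma apply_mat_cong:
  "(\<And>j. j < dim_col M \<Longrightarrow> u j = v j) \<Longrightarrow> apply_mat M u i = apply_mat M v i"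
  by (simp add: apply_mat_def)

lemma apply_mat_mult:
  assumes "A \<in> carrier_mat n n" "B \<in> carrier_mat n n" "i < n"
  shows "apply_mat (A * B) u i = apply_mat A (apply_mat B u) i"
proof -
  have "apply_mat (A * B) u i = (\<Sum>j<n. \<Sum>k<n. A $$ (i, k) * B $$ (k, j) * u j)"
    using assms by (auto simp: apply_mat_def scalar_prod_def lessThan_atLeast0 sum_distrib_right intro!: sum.cong)
  also have "\<dots> = (\<Sum>k<n. \<Sum>j<n. A $$ (i, k) * B $$ (k, j) * u j)" by (rule sum.swap)
  also have "\<dots> = apply_mat A (apply_mat B u) i"
    using assms by (simp add: apply_mat_def sum_distrib_left mult.assoc)
  finally show ?thesis .
qed

lemma apply_mat_diff:
  assumes "A \<in> carrier_mat n n" "B \<in> carrier_mat n n" "i < n"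
  shows "apply_mat (A - B) u i = apply_mat A u i - apply_mat B u i"
  using assms by (simp add: apply_mat_def left_diff_distrib sum_subtractf)

lemma apply_mat_sum:
  "apply_mat M (\<lambda>j. \<Sum>s\<in>S. c s * w s j) i = (\<Sum>s\<in>S. c s * apply_mat M (w s) i)"
proof -
  have "apply_mat M (\<lambda>j. \<Sum>s\<in>S. c s * w s j) i = (\<Sum>j<dim_col M. \<Sum>s\<in>S. c s * (M $$ (i, j) * w s j))"
    by (simp add: apply_mat_def sum_distrib_left mult.left_commute)
  also have "\<dots> = (\<Sum>s\<in>S. \<Sum>j<dim_col M. c s * (M $$ (i, j) * w s j))" by (rule sum.swap)
  finally show ?thesis by (simp add: apply_mat_def sum_distrib_left)
qed

lemma apply_mat_vec:
  assumes "M \<in> carrier_mat n n" "v \<in> carrier_vec n" "i < n"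
  shows "vec_index (M *\<^sub>v v) i = apply_mat M (vec_index v) i"
  using assms by (simp add: apply_mat_def scalar_prod_def lessThan_atLeast0)

lemma mat_diag_conj_entry:
  assumes "U \<in> carrier_mat n n" "W \<in> carrier_mat n n" "i < n" "j < n"
  shows "(U * mat_diag n f * W) $$ (i, j) = (\<Sum>q<n. U $$ (i, q) * f q * W $$ (q, j))"
proof -
  have "U * mat_diag n f = mat n n (\<lambda>(i, j). U $$ (i, j) * f j)"
    using assms by (intro mat_diag_mult_right)
  then show ?thesis using assms by (simp add: scalar_prod_def lessThan_atLeast0)
qed

lemma mat_diag_power: "mat_diag n f ^\<^sub>m k = mat_diag n (\<lambda>i. f i ^ k)"
  by (induction k) (simp_all add: power_commutes carrier_matD[OF mat_diag_dim])

text \<open>The powers of \<open>X\<close> are diagonalized by the same pair, so each entry of the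
  exponential series is a finite linear combination of scalar exponential series.\<close>

lemma mat_exp_similar_diag:
  assumes "similar_mat_wit X (mat_diag n \<mu>) U W" and X: "X \<in> carrier_mat n n"
  shows "mat_exp X = U * mat_diag n (\<lambda>q. exp (\<mu> q)) * W"
proof -
  have U: "U \<in> carrier_mat n n" and W: "W \<in> carrier_mat n n"
    using assms unfolding similar_mat_wit_def Let_def by auto
  have pow: "X ^\<^sub>m k = U * mat_diag n (\<lambda>q. \<mu> q ^ k) * W" for k
    using similar_mat_wit_pow_id[OF assms(1)] by (simp add: mat_diag_power)
  show ?thesis
  proof (rule eq_matI)
    fix i j assume "i < dim_row (U * mat_diag n (\<lambda>q. exp (\<mu> q)) * W)"
      "j < dim_col (U * mat_diag n (\<lambda>q. exp (\<mu> q)) * W)"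
    then have ij: "i < n" "j < n" using U W by auto
    have "(\<lambda>k. \<Sum>q<n. U $$ (i, q) * (\<mu> q ^ k /\<^sub>R fact k) * W $$ (q, j)) sums
        (\<Sum>q<n. U $$ (i, q) * exp (\<mu> q) * W $$ (q, j))"
      by (intro sums_sum sums_mult sums_mult2 exp_converges)
    moreover have "(X ^\<^sub>m k) $$ (i, j) / fact k = (\<Sum>q<n. U $$ (i, q) * (\<mu> q ^ k /\<^sub>R fact k) * W $$ (q, j))" for k
      unfolding pow mat_diag_conj_entry[OF U W ij] sum_divide_distrib
      by (intro sum.cong refl) (simp add: scaleR_conv_of_real divide_inverse mult_ac)
    ultimately have "(\<Sum>k. (X ^\<^sub>m k) $$ (i, j) / fact k) = (\<Sum>q<n. U $$ (i, q) * exp (\<mu> q) * W $$ (q, j))"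
      by (simp add: sums_iff)
    then show "mat_exp X $$ (i, j) = (U * mat_diag n (\<lambda>q. exp (\<mu> q)) * W) $$ (i, j)"
      using ij X by (simp only: mat_diag_conj_entry[OF U W ij]) (simp add: mat_exp_def)
  qed (use X U W in \<open>auto simp: mat_exp_def\<close>)
qed

section \<open>Fourier modes and the Euclidean norm\<close>

lemma L2_set_sum_le: "L2_set (\<lambda>i. \<Sum>s\<in>S. f s i) A \<le> (\<Sum>s\<in>S. L2_set (f s) A)"
proof (induction S rule: infinite_finite_induct)
  case (insert s S)
  then show ?case using L2_set_triangle_ineq[of "f s" "\<lambda>i. \<Sum>s\<in>S. f s i" A] by simp
qed (simp_all add: L2_set_def)

lemma vec_norm2_L2_set: "vec_norm2 v = L2_set (\<lambda>i. cmod (vec_index v i)) {..<dim_vec v}"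
  by (simp add: vec_norm2_def L2_set_def)

locale periodic_grid =
  fixes pos :: "'d::finite \<Rightarrow> nat" and N :: nat
  assumes pos: "bij_betw pos UNIV {..<CARD('d)}" and N: "N \<ge> 1"
begin


definition mode :: "('d \<Rightarrow> int) \<Rightarrow> nat \<Rightarrow> complex" where
  "mode p i = wave N p (digits pos N i)"

lemma norm_mode [simp]: "norm (mode p i) = 1"
  by (simp add: mode_def)

lemma mode_add: "mode (p + q) i = mode p i * mode q i"
  by (simp add: mode_def wave_add_left)

lemma mode_mod: "mode (\<lambda>c. p c mod int N) = mode p"
  by (simp add: fun_eq_iff mode_def wave_mod_left[OF N])

lemma sum_digits: "(\<Sum>i<N ^ CARD('d). g (digits pos N i)) = (\<Sum>j\<in>cube 0 N. g j)"
  by (rule sum.reindex_bij_betw[OF bij_betw_digits[OF pos N]])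

lemma mode_orthogonal:
  assumes "p \<in> cube 0 N" "q \<in> cube 0 N"
  shows "(\<Sum>i<N ^ CARD('d). mode p i * cnj (mode q i)) = of_nat (N ^ CARD('d)) * of_bool (p = q)"
  unfolding mode_def using sum_digits[of "\<lambda>j. wave N p j * cnj (wave N q j)"] sum_wave_diff[OF N assms]
  by simp

lemma mode_expansion:
  obtains \<alpha> where "\<And>i. i < (N ^ CARD('d)) \<Longrightarrow> v i = (\<Sum>p\<in>cube 0 N. \<alpha> p * mode p i)"
proof
  \<comment> \<open>The vector is carried to the cube along the inverse of \<open>digits\<close>;
    values off the cube do not enter \<open>dft\<close>.\<close>
  define f where "f j = v (inv_into {..<N ^ CARD('d)} (digits pos N) j)" for j
  fix i assume i: "i < N ^ CARD('d)"
  have "inj_on (digits pos N) {..<N ^ CARD('d)}"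
    using bij_betw_digits[OF pos N] by (simp add: bij_betw_def)
  then have "f (digits pos N i) = v i" using i by (simp add: f_def)
  then show "v i = (\<Sum>p\<in>cube 0 N. dft N f p * mode p i)"
    unfolding mode_def using dft_inversion[OF N digits_in_cube[OF N], where f = f and u = 0] by simp
qed

lemma parseval:
  "L2_set (\<lambda>i. cmod (\<Sum>p\<in>cube 0 N. \<alpha> p * mode p i)) {..<N ^ CARD('d)} =
    sqrt (real (N ^ CARD('d)) * (\<Sum>p\<in>cube 0 N. (cmod (\<alpha> p))\<^sup>2))"
proof -
  have "complex_of_real (\<Sum>i<N ^ CARD('d). (cmod (\<Sum>p\<in>cube 0 N. \<alpha> p * mode p i))\<^sup>2) =
      (\<Sum>i<N ^ CARD('d). \<Sum>p\<in>cube 0 N. \<Sum>q\<in>cube 0 N. \<alpha> p * cnj (\<alpha> q) * (mode p i * cnj (mode q i)))"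
    unfolding of_real_sum complex_norm_square cnj_sum sum_product complex_cnj_mult by (simp add: mult_ac)
  also have "\<dots> = (\<Sum>p\<in>cube 0 N. \<Sum>q\<in>cube 0 N. \<alpha> p * cnj (\<alpha> q) * (\<Sum>i<N ^ CARD('d). mode p i * cnj (mode q i)))"
    unfolding sum_distrib_left
    by (subst sum.swap) (intro sum.cong refl sum.swap)
  also have "\<dots> = (\<Sum>p\<in>cube 0 N. \<Sum>q\<in>cube 0 N. if q = p then \<alpha> p * cnj (\<alpha> p) * of_nat (N ^ CARD('d)) else 0)"
    by (intro sum.cong refl) (simp add: mode_orthogonal)
  also have "\<dots> = complex_of_real (real (N ^ CARD('d)) * (\<Sum>p\<in>cube 0 N. (cmod (\<alpha> p))\<^sup>2))"
    unfolding of_real_mult of_real_sum complex_norm_square by (simp add: sum_distrib_left mult_ac)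
  finally show ?thesis unfolding L2_set_def by (simp only: of_real_eq_iff)
qed

text \<open>For a fixed \<open>s\<close>, the map is a Fourier multiplier followed by multiplication
  with \<open>mode (g s)\<close>. The latter has modulus 1 at every grid point and preserves the
  norm, the former has norm at most \<open>\<beta> s\<close> by Parseval, and the triangle
  inequality sums over \<open>s\<close>. Splitting off the modulus-one factor keeps all frequencies
  inside the cube, where orthogonality is available.\<close>

lemma vec_norm2_mode_bound:
  assumes X: "X \<in> carrier_mat (N ^ CARD('d)) (N ^ CARD('d))" and v: "v \<in> carrier_vec (N ^ CARD('d))"
    and act: "\<And>p i. p \<in> cube 0 N \<Longrightarrow> i < (N ^ CARD('d)) \<Longrightarrow> apply_mat X (mode p) i = (\<Sum>s\<in>S. c s p * mode (p + g s) i)"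
    and c: "\<And>s p. s \<in> S \<Longrightarrow> cmod (c s p) \<le> \<beta> s"
  shows "vec_norm2 (X *\<^sub>v v) \<le> (\<Sum>s\<in>S. \<beta> s) * vec_norm2 v"
proof -
  obtain \<alpha> where \<alpha>: "\<And>i. i < (N ^ CARD('d)) \<Longrightarrow> vec_index v i = (\<Sum>p\<in>cube 0 N. \<alpha> p * mode p i)"
    by (rule mode_expansion[of "vec_index v"]) blast
  have Xv: "vec_index (X *\<^sub>v v) i = (\<Sum>s\<in>S. mode (g s) i * (\<Sum>p\<in>cube 0 N. \<alpha> p * c s p * mode p i))" if i: "i < N ^ CARD('d)" for i
  proof -
    have "vec_index (X *\<^sub>v v) i = apply_mat X (\<lambda>i. \<Sum>p\<in>cube 0 N. \<alpha> p * mode p i) i"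
      unfolding apply_mat_vec[OF X v i] using X by (intro apply_mat_cong \<alpha>) auto
    also have "\<dots> = (\<Sum>p\<in>cube 0 N. \<Sum>s\<in>S. mode (g s) i * (\<alpha> p * c s p * mode p i))"
      unfolding apply_mat_sum using i by (simp add: act sum_distrib_left mode_add mult_ac)
    also have "\<dots> = (\<Sum>s\<in>S. \<Sum>p\<in>cube 0 N. mode (g s) i * (\<alpha> p * c s p * mode p i))" by (rule sum.swap)
    finally show ?thesis by (simp add: sum_distrib_left)
  qed
  have "vec_norm2 (X *\<^sub>v v) = L2_set (\<lambda>i. cmod (vec_index (X *\<^sub>v v) i)) {..<N ^ CARD('d)}"
    using X by (simp add: vec_norm2_L2_set)
  also have "\<dots> \<le> L2_set (\<lambda>i. \<Sum>s\<in>S. cmod (\<Sum>p\<in>cube 0 N. \<alpha> p * c s p * mode p i)) {..<N ^ CARD('d)}"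
    by (intro L2_set_mono) (auto simp: Xv norm_mult intro!: order_trans[OF norm_sum])
  also have "\<dots> \<le> (\<Sum>s\<in>S. L2_set (\<lambda>i. cmod (\<Sum>p\<in>cube 0 N. \<alpha> p * c s p * mode p i)) {..<N ^ CARD('d)})"
    by (rule L2_set_sum_le)
  also have "\<dots> \<le> (\<Sum>s\<in>S. \<beta> s * vec_norm2 v)"
  proof (rule sum_mono)
    fix s assume s: "s \<in> S"
    have \<beta>: "0 \<le> \<beta> s" using c[OF s] norm_ge_zero order_trans by blast
    have "L2_set (\<lambda>i. cmod (\<Sum>p\<in>cube 0 N. (\<alpha> p * c s p) * mode p i)) {..<N ^ CARD('d)}
        = sqrt (real (N ^ CARD('d)) * (\<Sum>p\<in>cube 0 N. (cmod (\<alpha> p * c s p))\<^sup>2))" by (rule parseval)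
    also have "\<dots> \<le> sqrt (real (N ^ CARD('d)) * (\<Sum>p\<in>cube 0 N. (\<beta> s)\<^sup>2 * (cmod (\<alpha> p))\<^sup>2))"
    proof (intro real_sqrt_le_mono mult_left_mono sum_mono)
      fix p
      have "cmod (\<alpha> p * c s p) \<le> \<beta> s * cmod (\<alpha> p)"
        using mult_left_mono[OF c[OF s, of p], of "cmod (\<alpha> p)"] by (simp add: norm_mult mult.commute)
      then have "(cmod (\<alpha> p * c s p))\<^sup>2 \<le> (\<beta> s * cmod (\<alpha> p))\<^sup>2" by (intro power_mono) auto
      then show "(cmod (\<alpha> p * c s p))\<^sup>2 \<le> (\<beta> s)\<^sup>2 * (cmod (\<alpha> p))\<^sup>2" by (simp add: power_mult_distrib)
    qed simp
    also have "\<dots> = sqrt ((\<beta> s)\<^sup>2 * (real (N ^ CARD('d)) * (\<Sum>p\<in>cube 0 N. (cmod (\<alpha> p))\<^sup>2)))"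
      by (simp add: sum_distrib_left mult_ac)
    also have "\<dots> = \<beta> s * sqrt (real (N ^ CARD('d)) * (\<Sum>p\<in>cube 0 N. (cmod (\<alpha> p))\<^sup>2))"
      using \<beta> by (simp only: real_sqrt_mult real_sqrt_abs abs_of_nonneg)
    also have "sqrt (real (N ^ CARD('d)) * (\<Sum>p\<in>cube 0 N. (cmod (\<alpha> p))\<^sup>2)) = vec_norm2 v"
      unfolding parseval[symmetric] using v by (auto simp: vec_norm2_L2_set \<alpha> intro!: L2_set_cong)
    finally show "L2_set (\<lambda>i. cmod (\<Sum>p\<in>cube 0 N. \<alpha> p * c s p * mode p i)) {..<N ^ CARD('d)} \<le> \<beta> s * vec_norm2 v" .
  qed
  finally show ?thesis by (simp add: sum_distrib_right)
qed

section \<open>Diagonalization of the discrete Laplacian and its exponential\<close>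

lemma discA_carrier: "discA CARD('d) a b N \<in> carrier_mat (N ^ CARD('d)) (N ^ CARD('d))"
  by (simp add: discA_def)

lemma discB_carrier: "discB pos V a b N \<in> carrier_mat (N ^ CARD('d)) (N ^ CARD('d))"
  by (simp add: discB_def)

text \<open>The discrete Fourier matrix, with frequencies numbered by the same digit map as grid
  points, which makes it symmetric.\<close>

definition mode_mat :: "complex mat" where
  "mode_mat = mat (N ^ CARD('d)) (N ^ CARD('d)) (\<lambda>(i, q). mode (digits pos N q) i)"

definition mode_mat_inv :: "complex mat" where
  "mode_mat_inv = mat (N ^ CARD('d)) (N ^ CARD('d)) (\<lambda>(q, i). cnj (mode (digits pos N q) i) / of_nat (N ^ CARD('d)))"

lemma mode_symmetric: "mode (digits pos N q) i = mode (digits pos N i) q"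
  by (simp add: mode_def wave_commute)

lemma digits_eq_iff: "i < (N ^ CARD('d)) \<Longrightarrow> j < (N ^ CARD('d)) \<Longrightarrow> digits pos N i = digits pos N j \<longleftrightarrow> i = j"
  using bij_betw_digits[OF pos N] by (auto simp: bij_betw_def inj_on_def)

text \<open>One product is orthogonality of the columns; the symmetry of the matrix reduces the
  other product to the same relation.\<close>

lemma mode_mat_inverse: "mode_mat * mode_mat_inv = 1\<^sub>m (N ^ CARD('d))" "mode_mat_inv * mode_mat = 1\<^sub>m (N ^ CARD('d))"
proof -
  have *: "(\<Sum>i<N ^ CARD('d). mode (digits pos N p) i * cnj (mode (digits pos N q) i)) = of_nat (N ^ CARD('d)) * of_bool (p = q)"
    if "p < N ^ CARD('d)" "q < N ^ CARD('d)" for p q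
    using that by (simp add: mode_orthogonal digits_in_cube[OF N] digits_eq_iff)
  have dim_nz: "of_nat (N ^ CARD('d)) \<noteq> (0 :: complex)" using N by simp
  show "mode_mat * mode_mat_inv = 1\<^sub>m (N ^ CARD('d))"
  proof (rule eq_matI)
    fix i j assume "i < dim_row (1\<^sub>m (N ^ CARD('d)) :: complex mat)" "j < dim_col (1\<^sub>m (N ^ CARD('d)) :: complex mat)"
    then have ij: "i < N ^ CARD('d)" "j < N ^ CARD('d)" by simp_all
    have "(mode_mat * mode_mat_inv) $$ (i, j) =
      (\<Sum>q<N ^ CARD('d). mode (digits pos N q) i * cnj (mode (digits pos N q) j)) / of_nat (N ^ CARD('d))"
      using ij unfolding sum_divide_distrib
      by (simp add: mode_mat_def mode_mat_inv_def scalar_prod_def lessThan_atLeast0)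
    also have "\<dots> = (\<Sum>q<N ^ CARD('d). mode (digits pos N i) q * cnj (mode (digits pos N j) q)) / of_nat (N ^ CARD('d))"
      by (intro arg_cong2[of _ _ _ _ "(/)"] sum.cong refl) (simp only: mode_symmetric[of _ i] mode_symmetric[of _ j])
    finally show "(mode_mat * mode_mat_inv) $$ (i, j) = 1\<^sub>m (N ^ CARD('d)) $$ (i, j)"
      using ij dim_nz by (simp only: *[OF ij]) simp
  qed (auto simp: mode_mat_def mode_mat_inv_def)
  show "mode_mat_inv * mode_mat = 1\<^sub>m (N ^ CARD('d))"
  proof (rule eq_matI)
    fix i j assume "i < dim_row (1\<^sub>m (N ^ CARD('d)) :: complex mat)" "j < dim_col (1\<^sub>m (N ^ CARD('d)) :: complex mat)"
    then have ij: "i < N ^ CARD('d)" "j < N ^ CARD('d)" by simp_all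
    have "(mode_mat_inv * mode_mat) $$ (i, j) =
      (\<Sum>q<N ^ CARD('d). mode (digits pos N j) q * cnj (mode (digits pos N i) q)) / of_nat (N ^ CARD('d))"
      using ij unfolding sum_divide_distrib
      by (simp add: mode_mat_def mode_mat_inv_def scalar_prod_def lessThan_atLeast0 mult.commute)
    then show "(mode_mat_inv * mode_mat) $$ (i, j) = 1\<^sub>m (N ^ CARD('d)) $$ (i, j)"
      using ij dim_nz by (simp only: *[OF ij(2) ij(1)]) auto
  qed (auto simp: mode_mat_def mode_mat_inv_def)
qed

lemma mode_mat_carrier: "mode_mat \<in> carrier_mat (N ^ CARD('d)) (N ^ CARD('d))" "mode_mat_inv \<in> carrier_mat (N ^ CARD('d)) (N ^ CARD('d))"
  by (simp_all add: mode_mat_def mode_mat_inv_def)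

text \<open>The free scalar \<open>z\<close> lets one diagonalization serve both exponentials of
  \<open>conj_evol\<close>.\<close>

lemma scaled_discA_similar_diag:
  "similar_mat_wit (z \<cdot>\<^sub>m discA CARD('d) a b N)
    (mat_diag (N ^ CARD('d)) (\<lambda>q. z * of_real (eigenvalue (b - a) N (digits pos N q)))) mode_mat mode_mat_inv"
proof -
  let ?A = "z \<cdot>\<^sub>m discA CARD('d) a b N"
  let ?D = "mat_diag (N ^ CARD('d)) (\<lambda>q. z * of_real (eigenvalue (b - a) N (digits pos N q)))"
  note U = mode_mat_carrier
  have A: "?A \<in> carrier_mat (N ^ CARD('d)) (N ^ CARD('d))" using discA_carrier by simp
  have "?A * mode_mat = mode_mat * ?D"
  proof (rule eq_matI)
    fix i j assume "i < dim_row (mode_mat * ?D)" "j < dim_col (mode_mat * ?D)"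
    then have ij: "i < N ^ CARD('d)" "j < N ^ CARD('d)" using U by (auto simp: carrier_matD[OF mat_diag_dim])
    have "(?A * mode_mat) $$ (i, j) =
        z * (\<Sum>k<N ^ CARD('d). discA CARD('d) a b N $$ (i, k) * wave N (digits pos N j) (digits pos N k))"
      using ij discA_carrier[of a b] by (simp add: mode_mat_def mode_def scalar_prod_def lessThan_atLeast0 sum_distrib_left mult.assoc)
    also have "\<dots> = z * of_real (eigenvalue (b - a) N (digits pos N j)) * mode (digits pos N j) i"
      unfolding discA_eigen[OF pos N ij(1)] by (simp add: mode_def)
    also have "\<dots> = (mode_mat * ?D) $$ (i, j)"
      using ij by (subst mat_diag_mult_right[OF U(1)]) (simp add: mode_mat_def)
    finally show "(?A * mode_mat) $$ (i, j) = (mode_mat * ?D) $$ (i, j)" .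
  qed (use U A in \<open>auto simp: carrier_matD[OF mat_diag_dim]\<close>)
  then have "mode_mat * ?D * mode_mat_inv = ?A * mode_mat * mode_mat_inv" by simp
  also have "\<dots> = ?A"
    using A by (simp only: assoc_mult_mat[OF A U] mode_mat_inverse right_mult_one_mat)
  finally have "?A = mode_mat * ?D * mode_mat_inv" ..
  then show ?thesis
    using A U unfolding similar_mat_wit_def Let_def by (simp add: mode_mat_inverse)
qed

lemma mat_exp_carrier: "X \<in> carrier_mat n n \<Longrightarrow> mat_exp X \<in> carrier_mat n n"
  by (simp add: mat_exp_def)

lemma eigenvalue_mod: "eigenvalue L N (\<lambda>c. p c mod int N) = eigenvalue L N p"
proof -
  have "symbol N (m mod int N) = symbol N m" for m
    using cis_div_mod[OF N, of m 1] by (simp add: symbol_def complex_eq_iff)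
  then show ?thesis by (simp add: eigenvalue_def)
qed

lemma apply_mat_exp_discA:
  assumes i: "i < N ^ CARD('d)"
  shows "apply_mat (mat_exp (z \<cdot>\<^sub>m discA CARD('d) a b N)) (mode p) i =
    exp (z * of_real (eigenvalue (b - a) N p)) * mode p i"
proof -
  let ?A = "z \<cdot>\<^sub>m discA CARD('d) a b N"
  let ?e = "\<lambda>p. exp (z * of_real (eigenvalue (b - a) N p))"
  note U = mode_mat_carrier
  \<comment> \<open>The diagonalization only knows frequencies in the cube. An arbitrary
    \<open>p\<close> is reduced to its residue, which changes neither the mode nor the
    eigenvalue.\<close>
  define p' where "p' = (\<lambda>c. p c mod int N)"
  have A: "?A \<in> carrier_mat (N ^ CARD('d)) (N ^ CARD('d))" using discA_carrier by simp
  have p': "p' \<in> cube 0 N" using N by (auto simp: p'_def cube_def)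
  then have "p' \<in> digits pos N ` {..<N ^ CARD('d)}"
    using bij_betw_digits[OF pos N] by (simp add: bij_betw_def)
  then obtain q where q: "q < N ^ CARD('d)" "digits pos N q = p'"
    by auto
  have E: "mat_exp ?A = mode_mat * mat_diag (N ^ CARD('d)) (\<lambda>q. ?e (digits pos N q)) * mode_mat_inv"
    by (rule mat_exp_similar_diag[OF scaled_discA_similar_diag A])
  have "apply_mat (mat_exp ?A) (mode p') i =
      (\<Sum>j<N ^ CARD('d). (\<Sum>r<N ^ CARD('d). mode_mat $$ (i, r) * ?e (digits pos N r) * mode_mat_inv $$ (r, j)) * mode p' j)"
    unfolding apply_mat_def E using U i by (intro sum.cong) (auto simp: mat_diag_conj_entry[OF U i] simp del: index_mult_mat(1))
  also have "\<dots> = (\<Sum>r<N ^ CARD('d). mode (digits pos N r) i * ?e (digits pos N r) *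
      ((\<Sum>j<N ^ CARD('d). mode p' j * cnj (mode (digits pos N r) j)) / of_nat (N ^ CARD('d))))"
    unfolding sum_distrib_right sum_distrib_left sum_divide_distrib using i
    by (subst sum.swap) (auto simp: mode_mat_def mode_mat_inv_def intro!: sum.cong)
  also have "\<dots> = (\<Sum>r<N ^ CARD('d). if r = q then mode p' i * ?e p' else 0)"
  proof (intro sum.cong refl)
    fix r assume "r \<in> {..<N ^ CARD('d)}"
    then have r: "r < N ^ CARD('d)" by simp
    have "(\<Sum>j<N ^ CARD('d). mode p' j * cnj (mode (digits pos N r) j)) = of_nat (N ^ CARD('d)) * of_bool (r = q)"
      using q r digits_eq_iff[OF q(1) r] \<open>p' \<in> cube 0 N\<close> by (auto simp: mode_orthogonal digits_in_cube[OF N])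
    then show "mode (digits pos N r) i * ?e (digits pos N r) *
      ((\<Sum>j<N ^ CARD('d). mode p' j * cnj (mode (digits pos N r) j)) / of_nat (N ^ CARD('d))) = (if r = q then mode p' i * ?e p' else 0)"
      using q N by auto
  qed
  also have "\<dots> = ?e p' * mode p' i" using q by (simp add: mult.commute)
  finally show ?thesis unfolding p'_def mode_mod eigenvalue_mod .
qed

end

subsection \<open>Finite differences of the eigenvalues\<close>

lemma norm_cis_minus_1: "cmod (cis x - 1) \<le> \<bar>x\<bar>"
  using dist_exp_i_1[of x] abs_sin_x_le_abs_x[of "x / 2"] by (simp add: cis_conv_exp)

lemma norm_cis_diff: "cmod (cis x - cis y) \<le> \<bar>x - y\<bar>"
proof -
  have "cis x - cis y = cis y * (cis (x - y) - 1)" by (simp add: algebra_simps cis_mult)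
  then have "cmod (cis x - cis y) = cmod (cis (x - y) - 1)" by (simp add: norm_mult)
  then show ?thesis using norm_cis_minus_1[of "x - y"] by simp
qed

text \<open>If \<open>d\<close> completes the parallelogram, that is d = b + c - a, the combination
  factors into cis a (cis (b - a) - 1) (cis (c - a) - 1). The defect of \<open>d\<close> from this
  value is the second difference of the angles.\<close>

lemma norm_cis_second_diff:
  "cmod (cis a - cis b - cis c + cis d) \<le> \<bar>a - b - c + d\<bar> + \<bar>a - b\<bar> * \<bar>a - c\<bar>"
proof -
  have e: "cis a - cis b - cis c + cis (b + c - a) = cis a * ((cis (b - a) - 1) * (cis (c - a) - 1))"
    by (simp add: algebra_simps cis_mult)
  have "cis a - cis b - cis c + cis d = (cis d - cis (b + c - a)) + cis a * ((cis (b - a) - 1) * (cis (c - a) - 1))"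
    unfolding e[symmetric] by simp
  also have "cmod \<dots> \<le> cmod (cis d - cis (b + c - a)) + cmod (cis (b - a) - 1) * cmod (cis (c - a) - 1)"
    by (intro order_trans[OF norm_triangle_ineq]) (simp add: norm_mult)
  also have "\<dots> \<le> \<bar>d - (b + c - a)\<bar> + \<bar>b - a\<bar> * \<bar>c - a\<bar>"
    by (intro add_mono mult_mono norm_cis_diff norm_cis_minus_1) auto
  finally show ?thesis by (simp add: algebra_simps abs_minus_commute)
qed

text \<open>An iterated difference of \<open>cis\<close> factors into \<open>cis x\<close> times one
  factor \<open>cis \<alpha> - 1\<close> per increment; taking real parts gives the cosine.\<close>

lemma cos_second_diff:
  fixes x \<alpha> \<beta> :: real
  shows "\<bar>cos (x + \<alpha> + \<beta>) - cos (x + \<alpha>) - cos (x + \<beta>) + cos x\<bar> \<le> \<bar>\<alpha>\<bar> * \<bar>\<beta>\<bar>"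
proof -
  have "cis x * ((cis \<alpha> - 1) * (cis \<beta> - 1)) = cis (x + \<alpha> + \<beta>) - cis (x + \<alpha>) - cis (x + \<beta>) + cis x"
    by (simp add: algebra_simps cis_mult)
  from arg_cong[OF this, of Re]
  have "\<bar>cos (x + \<alpha> + \<beta>) - cos (x + \<alpha>) - cos (x + \<beta>) + cos x\<bar> = \<bar>Re (cis x * ((cis \<alpha> - 1) * (cis \<beta> - 1)))\<bar>"
    by (simp del: times_complex.simps)
  also have "\<dots> \<le> cmod (cis \<alpha> - 1) * cmod (cis \<beta> - 1)"
    by (intro order_trans[OF abs_Re_le_cmod]) (simp add: norm_mult)
  also have "\<dots> \<le> \<bar>\<alpha>\<bar> * \<bar>\<beta>\<bar>" by (intro mult_mono norm_cis_minus_1) auto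
  finally show ?thesis .
qed

lemma cos_third_diff:
  fixes x \<alpha> \<beta> \<gamma> :: real
  shows "\<bar>cos (x + \<alpha> + \<beta> + \<gamma>) - cos (x + \<alpha> + \<gamma>) - cos (x + \<beta> + \<gamma>) + cos (x + \<gamma>)
    - cos (x + \<alpha> + \<beta>) + cos (x + \<alpha>) + cos (x + \<beta>) - cos x\<bar> \<le> \<bar>\<alpha>\<bar> * \<bar>\<beta>\<bar> * \<bar>\<gamma>\<bar>"
proof -
  have "cis x * ((cis \<alpha> - 1) * (cis \<beta> - 1) * (cis \<gamma> - 1)) =
    cis (x + \<alpha> + \<beta> + \<gamma>) - cis (x + \<alpha> + \<gamma>) - cis (x + \<beta> + \<gamma>) + cis (x + \<gamma>)
    - cis (x + \<alpha> + \<beta>) + cis (x + \<alpha>) + cis (x + \<beta>) - cis x"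
    by (simp add: algebra_simps cis_mult)
  from arg_cong[OF this, of Re]
  have "\<bar>cos (x + \<alpha> + \<beta> + \<gamma>) - cos (x + \<alpha> + \<gamma>) - cos (x + \<beta> + \<gamma>) + cos (x + \<gamma>)
    - cos (x + \<alpha> + \<beta>) + cos (x + \<alpha>) + cos (x + \<beta>) - cos x\<bar> =
    \<bar>Re (cis x * ((cis \<alpha> - 1) * (cis \<beta> - 1) * (cis \<gamma> - 1)))\<bar>"
    by (simp del: times_complex.simps)
  also have "\<dots> \<le> cmod (cis \<alpha> - 1) * cmod (cis \<beta> - 1) * cmod (cis \<gamma> - 1)"
    by (intro order_trans[OF abs_Re_le_cmod]) (simp add: norm_mult)
  also have "\<dots> \<le> \<bar>\<alpha>\<bar> * \<bar>\<beta>\<bar> * \<bar>\<gamma>\<bar>" by (intro mult_mono norm_cis_minus_1) auto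
  finally show ?thesis .
qed

lemma symbol_second_diff:
  assumes N: "N \<ge> 1"
  shows "\<bar>symbol N (n + k + l) - symbol N (n + k) - symbol N (n + l) + symbol N n\<bar>
    \<le> 8 * pi\<^sup>2 * \<bar>real_of_int k\<bar> * \<bar>real_of_int l\<bar>"
proof -
  define t where "t m = 2 * pi * real_of_int m / real N" for m
  have t: "t (m + m') = t m + t m'" for m m' by (simp add: t_def ring_distribs add_divide_distrib)
  have "symbol N (n + k + l) - symbol N (n + k) - symbol N (n + l) + symbol N n =
    - 2 * (real N)\<^sup>2 * (cos (t n + t k + t l) - cos (t n + t k) - cos (t n + t l) + cos (t n))"
    unfolding symbol_def t_def[symmetric] t by (simp add: algebra_simps)
  also have "\<bar>\<dots>\<bar> = 2 * (real N)\<^sup>2 * \<bar>cos (t n + t k + t l) - cos (t n + t k) - cos (t n + t l) + cos (t n)\<bar>"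
    by (simp add: abs_mult)
  also have "\<dots> \<le> 2 * (real N)\<^sup>2 * (\<bar>t k\<bar> * \<bar>t l\<bar>)"
    by (intro mult_left_mono cos_second_diff) auto
  also have "\<dots> = 8 * pi\<^sup>2 * \<bar>real_of_int k\<bar> * \<bar>real_of_int l\<bar>"
    using N by (simp add: t_def abs_mult power2_eq_square)
  finally show ?thesis .
qed

text \<open>Every difference contributes an angle 2 pi k / N. Two of them cancel the prefactor
  \<open>N\<^sup>2\<close> of \<open>symbol\<close>, and the third leaves the decisive 1/N.\<close>

lemma symbol_third_diff:
  assumes N: "N \<ge> 1"
  shows "\<bar>symbol N (n + k + l + m) - symbol N (n + k + m) - symbol N (n + l + m) + symbol N (n + m)
    - symbol N (n + k + l) + symbol N (n + k) + symbol N (n + l) - symbol N n\<bar>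
    \<le> 16 * pi ^ 3 / real N * \<bar>real_of_int k\<bar> * \<bar>real_of_int l\<bar> * \<bar>real_of_int m\<bar>"
proof -
  define t where "t m = 2 * pi * real_of_int m / real N" for m
  have t: "t (m + m') = t m + t m'" for m m' by (simp add: t_def ring_distribs add_divide_distrib)
  let ?c = "cos (t n + t k + t l + t m) - cos (t n + t k + t m) - cos (t n + t l + t m) + cos (t n + t m)
    - cos (t n + t k + t l) + cos (t n + t k) + cos (t n + t l) - cos (t n)"
  have "symbol N (n + k + l + m) - symbol N (n + k + m) - symbol N (n + l + m) + symbol N (n + m)
    - symbol N (n + k + l) + symbol N (n + k) + symbol N (n + l) - symbol N n = - 2 * (real N)\<^sup>2 * ?c"
    unfolding symbol_def t_def[symmetric] t by (simp add: algebra_simps)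
  also have "\<bar>\<dots>\<bar> = 2 * (real N)\<^sup>2 * \<bar>?c\<bar>"
    by (simp add: abs_mult)
  also have "\<dots> \<le> 2 * (real N)\<^sup>2 * (\<bar>t k\<bar> * \<bar>t l\<bar> * \<bar>t m\<bar>)"
    by (intro mult_left_mono cos_third_diff) auto
  also have "\<dots> = 16 * pi ^ 3 / real N * \<bar>real_of_int k\<bar> * \<bar>real_of_int l\<bar> * \<bar>real_of_int m\<bar>"
    using N by (simp add: t_def abs_mult power2_eq_square power3_eq_cube field_simps)
  finally show ?thesis .
qed

lemma eigenvalue_second_diff:
  fixes p k l :: "'d::finite \<Rightarrow> int"
  assumes N: "N \<ge> 1"
  shows "\<bar>eigenvalue L N (p + k + l) - eigenvalue L N (p + k) - eigenvalue L N (p + l) + eigenvalue L N p\<bar>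
    \<le> 4 * pi\<^sup>2 * CARD('d) / L\<^sup>2 * (weight k * weight l)"
proof -
  have L: "0 \<le> 2 * L\<^sup>2" by simp
  have "eigenvalue L N (p + k + l) - eigenvalue L N (p + k) - eigenvalue L N (p + l) + eigenvalue L N p =
    (\<Sum>c\<in>UNIV. symbol N (p c + k c + l c) - symbol N (p c + k c) - symbol N (p c + l c) + symbol N (p c)) / (2 * L\<^sup>2)"
    by (simp add: eigenvalue_def sum.distrib sum_subtractf add_divide_distrib diff_divide_distrib)
  also have "\<bar>\<dots>\<bar> \<le> (\<Sum>c\<in>(UNIV :: 'd set). 8 * pi\<^sup>2 * (weight k * weight l)) / (2 * L\<^sup>2)"
    unfolding abs_divide abs_of_nonneg[OF L]
  proof (intro divide_right_mono order_trans[OF sum_abs] sum_mono)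
    fix c
    have "8 * pi\<^sup>2 * (\<bar>real_of_int (k c)\<bar> * \<bar>real_of_int (l c)\<bar>) \<le> 8 * pi\<^sup>2 * (weight k * weight l)"
      by (intro mult_left_mono mult_mono abs_le_weight) auto
    with symbol_second_diff[OF N, of "p c" "k c" "l c"] show "\<bar>symbol N (p c + k c + l c) - symbol N (p c + k c) - symbol N (p c + l c) + symbol N (p c)\<bar>
        \<le> 8 * pi\<^sup>2 * (weight k * weight l)" unfolding mult.assoc by (rule order_trans)
  qed auto
  also have "\<dots> = 4 * pi\<^sup>2 * CARD('d) / L\<^sup>2 * (weight k * weight l)"
    by simp
  finally show ?thesis .
qed

lemma eigenvalue_third_diff:
  fixes p k l m :: "'d::finite \<Rightarrow> int"
  assumes N: "N \<ge> 1"
  shows "\<bar>eigenvalue L N (p + k + l + m) - eigenvalue L N (p + k + m) - eigenvalue L N (p + l + m) + eigenvalue L N (p + m)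
    - eigenvalue L N (p + k + l) + eigenvalue L N (p + k) + eigenvalue L N (p + l) - eigenvalue L N p\<bar>
    \<le> 8 * pi ^ 3 * CARD('d) / L\<^sup>2 / real N * (weight k * weight l * weight m)"
proof -
  have L: "0 \<le> 2 * L\<^sup>2" by simp
  have scale: "n * (16 * x / y * v) / (2 * z) = 8 * x * n / z / y * v" for n x y z v :: real
    by (simp, simp only: mult_ac)
  have eq: "eigenvalue L N (p + k + l + m) - eigenvalue L N (p + k + m) - eigenvalue L N (p + l + m) + eigenvalue L N (p + m)
    - eigenvalue L N (p + k + l) + eigenvalue L N (p + k) + eigenvalue L N (p + l) - eigenvalue L N p =
    (\<Sum>c\<in>UNIV. symbol N (p c + k c + l c + m c) - symbol N (p c + k c + m c) - symbol N (p c + l c + m c)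
      + symbol N (p c + m c) - symbol N (p c + k c + l c) + symbol N (p c + k c) + symbol N (p c + l c)
      - symbol N (p c)) / (2 * L\<^sup>2)"
    by (simp add: eigenvalue_def sum.distrib sum_subtractf add_divide_distrib diff_divide_distrib)
  have "\<bar>(\<Sum>c\<in>UNIV. symbol N (p c + k c + l c + m c) - symbol N (p c + k c + m c) - symbol N (p c + l c + m c)
      + symbol N (p c + m c) - symbol N (p c + k c + l c) + symbol N (p c + k c) + symbol N (p c + l c)
      - symbol N (p c)) / (2 * L\<^sup>2)\<bar> \<le> (\<Sum>c\<in>(UNIV :: 'd set). 16 * pi ^ 3 / real N * (weight k * weight l * weight m)) / (2 * L\<^sup>2)"
    unfolding abs_divide abs_of_nonneg[OF L]
  proof (intro divide_right_mono order_trans[OF sum_abs] sum_mono)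
    fix c
    have "16 * pi ^ 3 / real N * (\<bar>real_of_int (k c)\<bar> * \<bar>real_of_int (l c)\<bar> * \<bar>real_of_int (m c)\<bar>)
        \<le> 16 * pi ^ 3 / real N * (weight k * weight l * weight m)"
      by (intro mult_left_mono mult_mono abs_le_weight) auto
    with symbol_third_diff[OF N, of "p c" "k c" "l c" "m c"] show "\<bar>symbol N (p c + k c + l c + m c) - symbol N (p c + k c + m c) - symbol N (p c + l c + m c)
      + symbol N (p c + m c) - symbol N (p c + k c + l c) + symbol N (p c + k c) + symbol N (p c + l c)
      - symbol N (p c)\<bar> \<le> 16 * pi ^ 3 / real N * (weight k * weight l * weight m)" unfolding mult.assoc by (rule order_trans)
  qed auto
  also have "\<dots> = 8 * pi ^ 3 * CARD('d) / L\<^sup>2 / real N * (weight k * weight l * weight m)"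
    unfolding sum_constant by (rule scale)
  finally show ?thesis by (simp only: eq)
qed

section \<open>Phases and the size of the commutator coefficients\<close>

lemma weight_add: "weight (k + l) \<le> weight k * weight l"
  unfolding weight_def prod.distrib[symmetric]
proof (intro prod_mono conjI)
  fix c
  have "\<bar>real_of_int ((k + l) c)\<bar> \<le> \<bar>real_of_int (k c)\<bar> + \<bar>real_of_int (l c)\<bar>" by simp
  moreover have "0 \<le> \<bar>real_of_int (k c)\<bar> * \<bar>real_of_int (l c)\<bar>" by simp
  ultimately show "1 + \<bar>real_of_int ((k + l) c)\<bar> \<le> (1 + \<bar>real_of_int (k c)\<bar>) * (1 + \<bar>real_of_int (l c)\<bar>)"
    unfolding distrib_left distrib_right by linarith
qed simp

text \<open>The angle picked up by the transition from mode \<open>p\<close> to mode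
  \<open>p + k\<close> under conjugation with the evolution for time \<open>t\<close>.\<close>

definition phase :: "real \<Rightarrow> nat \<Rightarrow> real \<Rightarrow> ('d::finite \<Rightarrow> int) \<Rightarrow> ('d \<Rightarrow> int) \<Rightarrow> real" where
  "phase L N t p k = t * (eigenvalue L N (p + k) - eigenvalue L N p)"

text \<open>Moving the base frequency turns the first difference of eigenvalues inside
  \<open>phase\<close>, which can be of order N, into a second difference, which is bounded.\<close>

lemma phase_diff:
  fixes p k l :: "'d::finite \<Rightarrow> int"
  assumes N: "N \<ge> 1" and t: "\<bar>t\<bar> \<le> \<delta>"
  shows "\<bar>phase L N t p l - phase L N t (p + k) l\<bar> \<le> \<delta> * (4 * pi\<^sup>2 * CARD('d) / L\<^sup>2 * (weight k * weight l))"
proof -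
  have "\<bar>phase L N t p l - phase L N t (p + k) l\<bar> =
    \<bar>t\<bar> * \<bar>eigenvalue L N (p + k + l) - eigenvalue L N (p + k) - eigenvalue L N (p + l) + eigenvalue L N p\<bar>"
    unfolding phase_def right_diff_distrib[symmetric] abs_mult by (simp add: abs_minus_commute algebra_simps)
  also have "\<dots> \<le> \<delta> * (4 * pi\<^sup>2 * CARD('d) / L\<^sup>2 * (weight k * weight l))"
    using t by (intro mult_mono eigenvalue_second_diff N) auto
  finally show ?thesis .
qed

text \<open>The frequencies \<open>k\<close>, \<open>l\<close>, \<open>m\<close> come from the time \<open>0\<close>, \<open>t\<close> and \<open>s\<close> factors respectively.\<close>

definition comm_coeff :: "real \<Rightarrow> nat \<Rightarrow> real \<Rightarrow> real \<Rightarrow> ('d::finite \<Rightarrow> int) \<Rightarrow> ('d \<Rightarrow> int) \<Rightarrow> ('d \<Rightarrow> int) \<Rightarrow> ('d \<Rightarrow> int) \<Rightarrow> complex" where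
  "comm_coeff L N s t k l m p =
    cis (phase L N s p m) * (cis (phase L N t (p + m) l) - cis (phase L N t (p + m + k) l))
    - cis (phase L N s (p + k + l) m) * (cis (phase L N t p l) - cis (phase L N t (p + k) l))"

lemma norm_comm_coeff_le:
  fixes p k l m :: "'d::finite \<Rightarrow> int"
  assumes N: "N \<ge> 1" and st: "\<bar>s\<bar> \<le> \<delta>" "\<bar>t\<bar> \<le> \<delta>" and \<delta>: "1 / real N \<le> \<delta>"
    and C2: "C2 = 4 * pi\<^sup>2 * CARD('d) / L\<^sup>2" and C3: "C3 = 8 * pi ^ 3 * CARD('d) / L\<^sup>2"
  shows "cmod (comm_coeff L N s t k l m p) \<le> (C3 + 2 * C2\<^sup>2) * \<delta>\<^sup>2 * (weight k * weight l * weight m)\<^sup>2"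
proof -
  define a where "a = phase L N t (p + m) l"
  define b where "b = phase L N t (p + m + k) l"
  define c where "c = phase L N t p l"
  define d where "d = phase L N t (p + k) l"
  define e where "e = phase L N s p m"
  define f where "f = phase L N s (p + k + l) m"
  let ?k = "weight k" and ?l = "weight l" and ?m = "weight m"
  have C: "0 \<le> C2" "0 \<le> C3" by (auto simp: C2 C3)
  have \<delta>0: "0 \<le> \<delta>" using st by simp
  have w: "1 \<le> ?k" "1 \<le> ?l" "1 \<le> ?m" by (rule weight_ge_1)+
  then have w0: "0 \<le> ?k" "0 \<le> ?l" "0 \<le> ?m" by auto
  \<comment> \<open>Used to bring the two quadratic terms to a common power of the weights;
    \<open>y\<close> will be 1 or \<open>weight k\<close>, and \<open>z\<close> will be 1.\<close>
  have le: "x * ?k\<^sup>2 * ?l\<^sup>2 * ?m\<^sup>2 \<ge> x * (y * ?k) * ?l\<^sup>2 * (z * ?m)" if "0 \<le> x" "0 \<le> y" "y \<le> ?k" "0 \<le> z" "z \<le> ?m" for x y z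
    unfolding power2_eq_square using that w0 by (intro mult_mono mult_nonneg_nonneg) auto
  have ab: "\<bar>a - b\<bar> \<le> \<delta> * (C2 * (?k * ?l))"
    unfolding a_def b_def C2 by (rule phase_diff[OF N st(2)])
  have ca: "\<bar>a - c\<bar> \<le> \<delta> * (C2 * (?m * ?l))"
    unfolding a_def c_def C2 using phase_diff[OF N st(2), of L p l m] by (simp add: abs_minus_commute)
  have cd: "\<bar>c - d\<bar> \<le> \<delta> * (C2 * (?k * ?l))"
    unfolding c_def d_def C2 by (rule phase_diff[OF N st(2)])
  have "\<bar>e - f\<bar> \<le> \<delta> * (C2 * (weight (k + l) * ?m))"
    unfolding e_def f_def C2 using phase_diff[OF N st(1), of L p m "k + l"] by (simp add: add.assoc)
  also have "\<dots> \<le> \<delta> * (C2 * (?k * ?l * ?m))"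
    using C \<delta>0 w0 by (intro mult_left_mono mult_right_mono weight_add) auto
  finally have ef: "\<bar>e - f\<bar> \<le> \<delta> * (C2 * (?k * ?l * ?m))" .
  \<comment> \<open>The combination is minus \<open>t\<close> times the third difference of the
    eigenvalues, hence the sign change under the absolute value.\<close>
  have "\<bar>a - b - c + d\<bar> = \<bar>t\<bar> * \<bar>eigenvalue L N (p + k + l + m) - eigenvalue L N (p + k + m) - eigenvalue L N (p + l + m)
      + eigenvalue L N (p + m) - eigenvalue L N (p + k + l) + eigenvalue L N (p + k) + eigenvalue L N (p + l) - eigenvalue L N p\<bar>"
    unfolding abs_mult[symmetric] a_def b_def c_def d_def phase_def
    by (subst abs_minus_cancel[symmetric]) (simp add: algebra_simps)
  also have "\<dots> \<le> \<delta> * (C3 / real N * (?k * ?l * ?m))"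
    using st(2) \<delta>0 unfolding C3 by (intro mult_mono eigenvalue_third_diff N) auto
  also have "\<dots> = (\<delta> * C3 * (?k * ?l * ?m)) * (1 / real N)" by simp
  \<comment> \<open>The hypothesis 1/N \<le> \<delta> turns the gain of the third difference into
    the second factor \<delta>.\<close>
  also have "\<dots> \<le> (\<delta> * C3 * (?k * ?l * ?m)) * \<delta>"
    using \<delta> \<delta>0 C w0 by (intro mult_left_mono) auto
  finally have abcd: "\<bar>a - b - c + d\<bar> \<le> C3 * \<delta>\<^sup>2 * (?k * ?l * ?m)" by (simp add: power2_eq_square mult_ac)
  \<comment> \<open>Obtained by adding and subtracting \<open>cis e * (cis c - cis d)\<close>: the
    first term is a second difference of exponentials, the second a product of two changes of
    phase.\<close>
  have "comm_coeff L N s t k l m p = cis e * (cis a - cis b - cis c + cis d) + (cis e - cis f) * (cis c - cis d)"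
    unfolding comm_coeff_def a_def b_def c_def d_def e_def f_def by (simp add: algebra_simps)
  also have "cmod \<dots> \<le> cmod (cis a - cis b - cis c + cis d) + cmod (cis e - cis f) * cmod (cis c - cis d)"
    by (intro order_trans[OF norm_triangle_ineq]) (simp add: norm_mult)
  also have "\<dots> \<le> (\<bar>a - b - c + d\<bar> + \<bar>a - b\<bar> * \<bar>a - c\<bar>) + \<bar>e - f\<bar> * \<bar>c - d\<bar>"
    by (intro add_mono mult_mono norm_cis_diff norm_cis_second_diff) auto
  also have "\<dots> \<le> (C3 * \<delta>\<^sup>2 * (?k * ?l * ?m) + \<delta> * (C2 * (?k * ?l)) * (\<delta> * (C2 * (?m * ?l))))
      + \<delta> * (C2 * (?k * ?l * ?m)) * (\<delta> * (C2 * (?k * ?l)))"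
    using \<delta>0 C w0 by (intro add_mono mult_mono ab ca cd ef abcd) auto
  also have "\<dots> = C3 * \<delta>\<^sup>2 * (?k * ?l * ?m) + C2\<^sup>2 * \<delta>\<^sup>2 * (1 * ?k) * ?l\<^sup>2 * (1 * ?m)
      + C2\<^sup>2 * \<delta>\<^sup>2 * (?k * ?k) * ?l\<^sup>2 * (1 * ?m)"
    by (simp add: power2_eq_square algebra_simps)
  also have "\<dots> \<le> C3 * \<delta>\<^sup>2 * (?k * ?l * ?m)\<^sup>2 + C2\<^sup>2 * \<delta>\<^sup>2 * ?k\<^sup>2 * ?l\<^sup>2 * ?m\<^sup>2 + C2\<^sup>2 * \<delta>\<^sup>2 * ?k\<^sup>2 * ?l\<^sup>2 * ?m\<^sup>2"
  proof (intro add_mono le mult_left_mono)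
    have "1 \<le> ?k * ?l * ?m" using mult_mono[OF mult_mono[OF w(1,2)] w(3)] w0 by simp
    then show "?k * ?l * ?m \<le> (?k * ?l * ?m)\<^sup>2" by (rule self_le_power) simp
  qed (use C w w0 in auto)
  also have "\<dots> = (C3 + 2 * C2\<^sup>2) * \<delta>\<^sup>2 * (?k * ?l * ?m)\<^sup>2"
    by (simp add: power_mult_distrib algebra_simps)
  finally show ?thesis .
qed

subsection \<open>The nested commutator\<close>

lemma op_norm_le:
  assumes "\<And>v. v \<in> carrier_vec (dim_col X) \<Longrightarrow> vec_norm2 (X *\<^sub>v v) \<le> C * vec_norm2 v" "0 \<le> C"
  shows "op_norm X \<le> C"
  unfolding op_norm_def
proof (rule cSUP_least)
  have "vec_norm2 (0\<^sub>v (dim_col X)) \<le> 1" by (simp add: vec_norm2_def)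
  then show "{v \<in> carrier_vec (dim_col X). vec_norm2 v \<le> 1} \<noteq> {}" by (auto intro!: exI[of _ "0\<^sub>v (dim_col X)"])
next
  fix v assume "v \<in> {v \<in> carrier_vec (dim_col X). vec_norm2 v \<le> 1}"
  then have v: "v \<in> carrier_vec (dim_col X)" "vec_norm2 v \<le> 1" by auto
  have "vec_norm2 (X *\<^sub>v v) \<le> C * vec_norm2 v" by (rule assms(1)[OF v(1)])
  also have "\<dots> \<le> C" using mult_left_mono[OF v(2) assms(2)] by simp
  finally show "vec_norm2 (X *\<^sub>v v) \<le> C" .
qed

text \<open>All four products are associated to the right, the shape handled by
  \<open>evolved_mult_triple\<close>.\<close>

lemma double_commutator_expand:
  fixes X Y Z :: "complex mat"
  assumes "X \<in> carrier_mat n n" "Y \<in> carrier_mat n n" "Z \<in> carrier_mat n n"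
  shows "commutator (commutator X Y) Z = (X * (Y * Z) - Y * (X * Z)) - (Z * (X * Y) - Z * (Y * X))"
proof -
  have "X * Y \<in> carrier_mat n n" "Y * X \<in> carrier_mat n n" using assms by auto
  then show ?thesis
    using assms unfolding commutator_def
    by (simp add: minus_mult_distrib_mat[of _ n n _ _ n] mult_minus_distrib_mat[of _ n n _ n] assoc_mult_mat[of _ n n _ n _ n])
qed

lemma sum_rotate:
  "(\<Sum>a\<in>A. \<Sum>b\<in>B. \<Sum>c\<in>C. f a b c) = (\<Sum>c\<in>C. \<Sum>a\<in>A. \<Sum>b\<in>B. f a b c)"
proof -
  have "(\<Sum>a\<in>A. \<Sum>b\<in>B. \<Sum>c\<in>C. f a b c) = (\<Sum>a\<in>A. \<Sum>c\<in>C. \<Sum>b\<in>B. f a b c)"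
    by (intro sum.cong refl sum.swap)
  also have "\<dots> = (\<Sum>c\<in>C. \<Sum>a\<in>A. \<Sum>b\<in>B. f a b c)" by (rule sum.swap)
  finally show ?thesis .
qed

context periodic_grid
begin

text \<open>A matrix acting on modes like the Heisenberg evolution for time \<open>t\<close> of a multiplication
  operator whose Fourier coefficients are \<open>w\<close>.\<close>

definition evolved_mult :: "real \<Rightarrow> (('d \<Rightarrow> int) \<Rightarrow> complex) \<Rightarrow> real \<Rightarrow> complex mat \<Rightarrow> bool" where
  "evolved_mult L w t Y \<longleftrightarrow> Y \<in> carrier_mat (N ^ CARD('d)) (N ^ CARD('d)) \<and>
    (\<forall>p. \<forall>i<N ^ CARD('d). apply_mat Y (mode p) i =
      (\<Sum>k\<in>centred_cube N. w k * cis (phase L N t p k) * mode (p + k) i))"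

lemma evolved_mult_carrier: "evolved_mult L w t Y \<Longrightarrow> Y \<in> carrier_mat (N ^ CARD('d)) (N ^ CARD('d))"
  by (simp add: evolved_mult_def)

lemma evolved_mult_apply:
  assumes "evolved_mult L w t Y" "i < N ^ CARD('d)"
    and u: "\<And>j. j < N ^ CARD('d) \<Longrightarrow> u j = (\<Sum>s\<in>S. c s * mode (q s) j)"
  shows "apply_mat Y u i = (\<Sum>s\<in>S. \<Sum>k\<in>centred_cube N. c s * (w k * cis (phase L N t (q s) k)) * mode (q s + k) i)"
proof -
  have "apply_mat Y u i = apply_mat Y (\<lambda>j. \<Sum>s\<in>S. c s * mode (q s) j) i"
    using evolved_mult_carrier[OF assms(1)] by (intro apply_mat_cong u) auto
  then show ?thesis
    using assms(1,2) unfolding apply_mat_sum evolved_mult_def by (simp add: sum_distrib_left mult.assoc)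
qed

lemma discB_evolved_mult:
  "evolved_mult (b - a) (dft N (\<lambda>j. V (node a (b - a) N j))) 0 (discB pos V a b N)"
  unfolding evolved_mult_def
proof (intro conjI allI impI)
  fix p i assume i: "i < N ^ CARD('d)"
  let ?w = "dft N (\<lambda>j. V (node a (b - a) N j))"
  have "apply_mat (discB pos V a b N) (mode p) i =
      (\<Sum>j<N ^ CARD('d). if j = i then V (node a (b - a) N (digits pos N i)) * mode p i else 0)"
    unfolding apply_mat_def using i carrier_matD[OF discB_carrier[of V a b]]
    by (intro sum.cong) (auto simp: discB_def mat_diag_def grid_point_eq_node)
  also have "\<dots> = V (node a (b - a) N (digits pos N i)) * mode p i" using i by simp
  also have "V (node a (b - a) N (digits pos N i)) = (\<Sum>k\<in>centred_cube N. ?w k * mode k i)"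
    unfolding mode_def centred_cube_def by (rule dft_inversion[OF N digits_in_cube[OF N], symmetric])
  finally show "apply_mat (discB pos V a b N) (mode p) i =
      (\<Sum>k\<in>centred_cube N. ?w k * cis (phase (b - a) N 0 p k) * mode (p + k) i)"
    by (simp add: sum_distrib_left sum_distrib_right mode_add phase_def mult_ac)
qed (rule discB_carrier)

text \<open>The right exponential gives mode \<open>p\<close> the phase of its own eigenvalue with a
  minus sign, \<open>B\<close> moves it to \<open>p + k\<close>, and the left exponential adds the
  phase of the new eigenvalue.\<close>

lemma conj_evol_evolved_mult:
  assumes "evolved_mult (b - a) w 0 B"
  shows "evolved_mult (b - a) w t (conj_evol (discA CARD('d) a b N) B t)"
  unfolding evolved_mult_def
proof (intro conjI allI impI)
  let ?A = "discA CARD('d) a b N" and ?n = "N ^ CARD('d)"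
  let ?E = "mat_exp ((\<i> * of_real t) \<cdot>\<^sub>m ?A)" and ?F = "mat_exp ((- \<i> * of_real t) \<cdot>\<^sub>m ?A)"
  let ?lam = "eigenvalue (b - a) N"
  have B: "B \<in> carrier_mat ?n ?n" by (rule evolved_mult_carrier[OF assms])
  have E: "?E \<in> carrier_mat ?n ?n" "?F \<in> carrier_mat ?n ?n"
    using discA_carrier by (auto intro!: mat_exp_carrier)
  then show carrier: "conj_evol ?A B t \<in> carrier_mat ?n ?n"
    using B unfolding conj_evol_def by (intro mult_carrier_mat)
  fix p i assume i: "i < ?n"
  have F: "apply_mat ?F (mode p) j = exp ((- \<i> * of_real t) * of_real (?lam p)) * mode p j" if "j < ?n" for j
    by (rule apply_mat_exp_discA[OF that])
  have BF: "apply_mat B (apply_mat ?F (mode p)) j =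
      (\<Sum>k\<in>centred_cube N. (exp ((- \<i> * of_real t) * of_real (?lam p)) * w k) * mode (p + k) j)" if j: "j < ?n" for j
    \<comment> \<open>A one-point index set presents the single mode as a superposition.\<close>
    using evolved_mult_apply[OF assms j, where u = "apply_mat ?F (mode p)" and S = "{()}"
        and c = "\<lambda>_. exp ((- \<i> * of_real t) * of_real (?lam p))" and q = "\<lambda>_. p"] F
    by (simp add: phase_def)
  have "apply_mat (conj_evol ?A B t) (mode p) i = apply_mat ?E (apply_mat B (apply_mat ?F (mode p))) i"
  proof -
    have "apply_mat (conj_evol ?A B t) (mode p) i = apply_mat (?E * B) (apply_mat ?F (mode p)) i"
      unfolding conj_evol_def using E B i by (intro apply_mat_mult[of _ ?n]) auto
    also have "\<dots> = apply_mat ?E (apply_mat B (apply_mat ?F (mode p))) i"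
      using E B i by (intro apply_mat_mult[of _ ?n])
    finally show ?thesis .
  qed
  also have "\<dots> = apply_mat ?E (\<lambda>j. \<Sum>k\<in>centred_cube N. (exp ((- \<i> * of_real t) * of_real (?lam p)) * w k) * mode (p + k) j) i"
    using E by (intro apply_mat_cong BF) auto
  also have "\<dots> = (\<Sum>k\<in>centred_cube N. (exp ((- \<i> * of_real t) * of_real (?lam p)) * w k) *
      (exp ((\<i> * of_real t) * of_real (?lam (p + k))) * mode (p + k) i))"
    unfolding apply_mat_sum apply_mat_exp_discA[OF i] ..
  also have "\<dots> = (\<Sum>k\<in>centred_cube N. w k * cis (phase (b - a) N t p k) * mode (p + k) i)"
  proof (intro sum.cong refl)
    fix k
    have "cis (phase (b - a) N t p k) =
        exp ((- \<i> * of_real t) * of_real (?lam p)) * exp ((\<i> * of_real t) * of_real (?lam (p + k)))"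
      unfolding cis_conv_exp phase_def exp_add[symmetric] by (simp add: algebra_simps)
    then show "(exp ((- \<i> * of_real t) * of_real (?lam p)) * w k) *
      (exp ((\<i> * of_real t) * of_real (?lam (p + k))) * mode (p + k) i) = w k * cis (phase (b - a) N t p k) * mode (p + k) i"
      by simp
  qed
  finally show "apply_mat (conj_evol ?A B t) (mode p) i =
      (\<Sum>k\<in>centred_cube N. w k * cis (phase (b - a) N t p k) * mode (p + k) i)" .
qed

text \<open>The rightmost factor acts first, so each phase is based at the frequency reached so far:
  \<open>p\<close>, then \<open>p + m\<close>, then \<open>p + m + l\<close>.\<close>

lemma evolved_mult_triple:
  assumes X: "evolved_mult L w r X" and Y: "evolved_mult L w s Y" and Z: "evolved_mult L w t Z"
    and i: "i < N ^ CARD('d)"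
  shows "apply_mat (X * (Y * Z)) (mode p) i =
    (\<Sum>m\<in>centred_cube N. \<Sum>l\<in>centred_cube N. \<Sum>k\<in>centred_cube N.
      w m * w l * w k * (cis (phase L N t p m) * cis (phase L N s (p + m) l) * cis (phase L N r (p + m + l) k)) *
      mode (p + (k + l + m)) i)"
proof -
  let ?n = "N ^ CARD('d)" and ?K = "centred_cube N :: ('d \<Rightarrow> int) set"
  have C: "X \<in> carrier_mat ?n ?n" "Y \<in> carrier_mat ?n ?n" "Z \<in> carrier_mat ?n ?n"
    using X Y Z by (auto dest: evolved_mult_carrier)
  have Zp: "apply_mat Z (mode p) j = (\<Sum>m\<in>?K. (w m * cis (phase L N t p m)) * mode (p + m) j)" if "j < ?n" for j
    using Z that by (simp add: evolved_mult_def)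
  have YZp: "apply_mat (Y * Z) (mode p) j = (\<Sum>(m, l)\<in>?K \<times> ?K.
      (w m * cis (phase L N t p m)) * (w l * cis (phase L N s (p + m) l)) * mode (p + m + l) j)" if j: "j < ?n" for j
  proof -
    have "apply_mat (Y * Z) (mode p) j = apply_mat Y (apply_mat Z (mode p)) j"
      by (rule apply_mat_mult[OF C(2,3) j])
    also have "\<dots> = (\<Sum>m\<in>?K. \<Sum>l\<in>?K. (w m * cis (phase L N t p m)) * (w l * cis (phase L N s (p + m) l)) * mode (p + m + l) j)"
      by (rule evolved_mult_apply[OF Y j Zp])
    also have "\<dots> = (\<Sum>(m, l)\<in>?K \<times> ?K.
      (w m * cis (phase L N t p m)) * (w l * cis (phase L N s (p + m) l)) * mode (p + m + l) j)"
      by (rule sum.cartesian_product)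
    finally show ?thesis .
  qed
  have "apply_mat (X * (Y * Z)) (mode p) i = (\<Sum>(m, l)\<in>?K \<times> ?K. \<Sum>k\<in>?K.
      (w m * cis (phase L N t p m)) * (w l * cis (phase L N s (p + m) l)) *
      (w k * cis (phase L N r (p + m + l) k)) * mode (p + m + l + k) i)"
    using YZp unfolding apply_mat_mult[OF C(1) mult_carrier_mat[OF C(2,3)] i]
    by (subst evolved_mult_apply[OF X i, where S = "?K \<times> ?K"
          and c = "\<lambda>(m, l). (w m * cis (phase L N t p m)) * (w l * cis (phase L N s (p + m) l))"
          and q = "\<lambda>(m, l). p + m + l"])
      (simp_all add: case_prod_unfold)
  also have "\<dots> = (\<Sum>m\<in>?K. \<Sum>l\<in>?K. \<Sum>k\<in>?K. 
      w m * w l * w k * (cis (phase L N t p m) * cis (phase L N s (p + m) l) * cis (phase L N r (p + m + l) k)) *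
      mode (p + (k + l + m)) i)"
    unfolding sum.cartesian_product[symmetric]
    by (intro sum.cong refl) (simp add: add_ac mult_ac)
  finally show ?thesis .
qed

text \<open>In each of the four products the summation variables are permuted until \<open>k\<close>
  belongs to \<open>B\<close>, \<open>l\<close> to \<open>T\<close> and \<open>m\<close> to
  \<open>S\<close>. Coefficients and final mode then agree, and only the phases differ;
  \<open>B\<close> contributes none, its time being 0.\<close>

lemma double_commutator_apply:
  assumes B: "evolved_mult L w 0 B" and T: "evolved_mult L w t T" and S: "evolved_mult L w s S"
    and i: "i < N ^ CARD('d)"
  shows "apply_mat (commutator (commutator B T) S) (mode p) i =
    (\<Sum>(m, l, k)\<in>centred_cube N \<times> centred_cube N \<times> centred_cube N.
      w m * w l * w k * comm_coeff L N s t k l m p * mode (p + (k + l + m)) i)"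
proof -
  let ?n = "N ^ CARD('d)" and ?K = "centred_cube N :: ('d \<Rightarrow> int) set"
  have C: "B \<in> carrier_mat ?n ?n" "T \<in> carrier_mat ?n ?n" "S \<in> carrier_mat ?n ?n"
    using B T S by (auto dest: evolved_mult_carrier)
  define P where "P = (\<lambda>(q :: 'd \<Rightarrow> int) r. cis (phase L N t q r))"
  define Q where "Q = (\<lambda>(q :: 'd \<Rightarrow> int) r. cis (phase L N s q r))"
  have zero: "cis (phase L N 0 q r) = 1" for q r :: "'d \<Rightarrow> int" by (simp add: phase_def)
  define f where "f = (\<lambda>m l k. w m * w l * w k)"
  define g where "g = (\<lambda>m l k. mode (p + (k + l + m)) i)"
  have BTS: "apply_mat (B * (T * S)) (mode p) i = (\<Sum>m\<in>?K. \<Sum>l\<in>?K. \<Sum>k\<in>?K.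
      f m l k * (Q p m * P (p + m) l) * g m l k)"
    unfolding evolved_mult_triple[OF B T S i] zero f_def g_def P_def Q_def by simp
  have TBS: "apply_mat (T * (B * S)) (mode p) i = (\<Sum>m\<in>?K. \<Sum>l\<in>?K. \<Sum>k\<in>?K.
      f m l k * (Q p m * P (p + m + k) l) * g m l k)"
    unfolding evolved_mult_triple[OF T B S i] zero f_def g_def P_def Q_def
    by (rule sum.cong[OF refl], subst sum.swap) (simp add: mult_ac add_ac)
  have SBT: "apply_mat (S * (B * T)) (mode p) i = (\<Sum>m\<in>?K. \<Sum>l\<in>?K. \<Sum>k\<in>?K.
      f m l k * (P p l * Q (p + k + l) m) * g m l k)"
    unfolding evolved_mult_triple[OF S B T i] zero f_def g_def P_def Q_def
    by (subst sum_rotate) (simp add: mult_ac add_ac)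
  have STB: "apply_mat (S * (T * B)) (mode p) i = (\<Sum>m\<in>?K. \<Sum>l\<in>?K. \<Sum>k\<in>?K.
      f m l k * (P (p + k) l * Q (p + k + l) m) * g m l k)"
    unfolding evolved_mult_triple[OF S T B i] zero f_def g_def P_def Q_def
    by (subst sum_rotate, rule sum.cong[OF refl], subst sum.swap) (simp add: mult_ac add_ac)
  have "apply_mat (commutator (commutator B T) S) (mode p) i =
      (apply_mat (B * (T * S)) (mode p) i - apply_mat (T * (B * S)) (mode p) i) -
      (apply_mat (S * (B * T)) (mode p) i - apply_mat (S * (T * B)) (mode p) i)"
    unfolding double_commutator_expand[OF C] using C i
    by (simp add: apply_mat_diff[of _ ?n] mult_carrier_mat[of _ ?n ?n] minus_carrier_mat[of _ ?n ?n])
  also have "\<dots> = (\<Sum>m\<in>?K. \<Sum>l\<in>?K. \<Sum>k\<in>?K. f m l k * comm_coeff L N s t k l m p * g m l k)"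
    unfolding BTS TBS SBT STB sum_subtractf[symmetric] comm_coeff_def P_def Q_def
    by (intro sum.cong refl) (simp add: algebra_simps)
  finally show ?thesis by (simp add: sum.cartesian_product f_def g_def case_prod_unfold)
qed

text \<open>The coefficient bound splits into one squared weight per frequency, so the sum over
  triples factors into the cube of a single weighted sum of Fourier coefficients.\<close>

lemma op_norm_double_commutator_le:
  assumes B: "evolved_mult L w 0 B" and T: "evolved_mult L w t T" and S: "evolved_mult L w s S"
    and st: "\<bar>s\<bar> \<le> \<delta>" "\<bar>t\<bar> \<le> \<delta>" and \<delta>: "1 / real N \<le> \<delta>"
    and C2: "C2 = 4 * pi\<^sup>2 * CARD('d) / L\<^sup>2" and C3: "C3 = 8 * pi ^ 3 * CARD('d) / L\<^sup>2"
    and w: "(\<Sum>k\<in>centred_cube N. cmod (w k) * (weight k)\<^sup>2) \<le> M"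
  shows "op_norm (commutator (commutator B T) S) \<le> (C3 + 2 * C2\<^sup>2) * M ^ 3 * \<delta>\<^sup>2"
proof -
  let ?n = "N ^ CARD('d)" and ?K = "centred_cube N :: ('d \<Rightarrow> int) set"
  let ?X = "commutator (commutator B T) S"
  let ?D = "(C3 + 2 * C2\<^sup>2) * \<delta>\<^sup>2"
  have C: "B \<in> carrier_mat ?n ?n" "T \<in> carrier_mat ?n ?n" "S \<in> carrier_mat ?n ?n"
    using B T S by (auto dest: evolved_mult_carrier)
  then have X: "?X \<in> carrier_mat ?n ?n" unfolding commutator_def by (auto intro!: minus_carrier_mat mult_carrier_mat)
  have D': "0 \<le> C3 + 2 * C2\<^sup>2" unfolding C2 C3 by simp
  then have D: "0 \<le> ?D" by simp
  define W where "W = (\<Sum>k\<in>?K. cmod (w k) * (weight k)\<^sup>2)"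
  have W: "0 \<le> W" unfolding W_def by (intro sum_nonneg) simp
  define \<beta> where "\<beta> = (\<lambda>(m, l, k). ?D * ((cmod (w m) * (weight m)\<^sup>2) * ((cmod (w l) * (weight l)\<^sup>2) * (cmod (w k) * (weight k)\<^sup>2))))"
  have "(\<Sum>s\<in>?K \<times> ?K \<times> ?K. \<beta> s) = (\<Sum>m\<in>?K. \<Sum>l\<in>?K. \<Sum>k\<in>?K. \<beta> (m, l, k))"
    by (simp add: sum.cartesian_product case_prod_unfold)
  also have "\<dots> = ?D * (W * (W * W))"
    unfolding \<beta>_def W_def by (simp only: sum_distrib_left sum_distrib_right sum_product prod.case mult_ac)
  also have "\<dots> \<le> ?D * (M * (M * M))"
    using w W D' unfolding W_def[symmetric] by (intro mult_left_mono mult_mono mult_nonneg_nonneg) auto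
  finally have sum: "(\<Sum>s\<in>?K \<times> ?K \<times> ?K. \<beta> s) \<le> (C3 + 2 * C2\<^sup>2) * M ^ 3 * \<delta>\<^sup>2"
    by (simp add: power3_eq_cube mult_ac)
  have bound: "vec_norm2 (?X *\<^sub>v v) \<le> (\<Sum>s\<in>?K \<times> ?K \<times> ?K. \<beta> s) * vec_norm2 v" if v: "v \<in> carrier_vec ?n" for v
  proof (rule vec_norm2_mode_bound[OF X v, where g = "\<lambda>(m, l, k). k + l + m"
        and c = "\<lambda>(m, l, k) p. w m * w l * w k * comm_coeff L N s t k l m p"])
    fix p i assume "i < ?n"
    then show "apply_mat ?X (mode p) i = (\<Sum>x\<in>?K \<times> ?K \<times> ?K.
      (case x of (m, l, k) \<Rightarrow> \<lambda>p. w m * w l * w k * comm_coeff L N s t k l m p) p * mode (p + (case x of (m, l, k) \<Rightarrow> k + l + m)) i)"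
      by (simp add: double_commutator_apply[OF B T S] case_prod_unfold)
  next
    fix x p assume "x \<in> ?K \<times> ?K \<times> ?K"
    obtain m l k where x: "x = (m, l, k)" by (cases x) auto
    have "cmod (w m * w l * w k * comm_coeff L N s t k l m p) \<le>
        (cmod (w m) * cmod (w l) * cmod (w k)) * (?D * (weight k * weight l * weight m)\<^sup>2)"
      using norm_comm_coeff_le[OF N st \<delta> C2 C3, of k l m p] unfolding norm_mult
      by (intro mult_left_mono) auto
    then show "cmod ((case x of (m, l, k) \<Rightarrow> \<lambda>p. w m * w l * w k * comm_coeff L N s t k l m p) p) \<le> \<beta> x"
      by (simp add: x \<beta>_def power_mult_distrib mult_ac)
  qed
  show ?thesis
  proof (rule order_trans[OF op_norm_le sum])
    show "vec_norm2 (?X *\<^sub>v v) \<le> (\<Sum>s\<in>?K \<times> ?K \<times> ?K. \<beta> s) * vec_norm2 v" if "v \<in> carrier_vec (dim_col ?X)" for v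
      using bound[of v] that X by auto
    show "0 \<le> (\<Sum>s\<in>?K \<times> ?K \<times> ?K. \<beta> s)"
      using D by (intro sum_nonneg) (auto simp: \<beta>_def)
  qed
qed

end

text \<open>Taking the supremum in \<open>ereal\<close> makes the inequality a bound for every pair
  of times, with no separate boundedness condition.\<close>

theorem theorem4:
  fixes a b :: real
    and V :: "real ^ 'd::finite \<Rightarrow> complex"
    and pos :: "'d \<Rightarrow> nat"
  assumes "a < b"
    and "bij_betw pos UNIV {..<CARD('d)}"
    and "V \<in> S1"
    and "coord_periodic (b - a) V"
  shows "\<exists>C::real. \<forall>N::nat. \<forall>\<Delta>t::real. N \<ge> 1 \<longrightarrow> 1 / real N \<le> \<Delta>t \<longrightarrow> \<Delta>t \<le> 1 \<longrightarrow>
    (let A = discA CARD('d) a b N; B = discB pos V a b N in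
      (SUP (s, \<tau>) \<in> {-\<Delta>t..\<Delta>t} \<times> {-\<Delta>t..\<Delta>t}.
         ereal (op_norm (commutator (commutator B (conj_evol A B \<tau>)) (conj_evol A B s))))
      \<le> ereal (C * \<Delta>t\<^sup>2))"
proof -
  define w :: "nat \<Rightarrow> ('d \<Rightarrow> int) \<Rightarrow> complex" where "w N = dft N (\<lambda>j. V (node a (b - a) N j))" for N
  obtain C0 where C0: "C0 \<ge> 0" "\<And>N k. N \<ge> 1 \<Longrightarrow> k \<in> centred_cube N \<Longrightarrow> cmod (w N k) \<le> C0 / weight k ^ 4"
    using dft_decay[OF assms(3,4), of a] unfolding w_def by blast
  obtain C1 where C1: "\<And>N. (\<Sum>k\<in>(centred_cube N :: ('d \<Rightarrow> int) set). 1 / (weight k)\<^sup>2) \<le> C1"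
    using sum_inverse_weight_bounded by blast
  define C2 where "C2 = 4 * pi\<^sup>2 * CARD('d) / (b - a)\<^sup>2"
  define C3 where "C3 = 8 * pi ^ 3 * CARD('d) / (b - a)\<^sup>2"
  have sum_w: "(\<Sum>k\<in>centred_cube N. cmod (w N k) * (weight k)\<^sup>2) \<le> C0 * C1" if N: "N \<ge> 1" for N
  proof -
    have "(\<Sum>k\<in>centred_cube N. cmod (w N k) * (weight k)\<^sup>2) \<le> (\<Sum>k\<in>(centred_cube N :: ('d \<Rightarrow> int) set). C0 * (1 / (weight k)\<^sup>2))"
    proof (rule sum_mono)
      fix k :: "'d \<Rightarrow> int" assume k: "k \<in> centred_cube N"
      have "weight k \<noteq> 0" using weight_ge_1[of k] by linarith
      have "cmod (w N k) * (weight k)\<^sup>2 \<le> C0 / weight k ^ 4 * (weight k)\<^sup>2"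
        by (intro mult_right_mono C0(2) N k) simp
      also have "\<dots> = C0 * (1 / (weight k)\<^sup>2)"
        using \<open>weight k \<noteq> 0\<close> by (simp add: field_simps flip: power_add)
      finally show "cmod (w N k) * (weight k)\<^sup>2 \<le> C0 * (1 / (weight k)\<^sup>2)" .
    qed
    also have "\<dots> \<le> C0 * C1" unfolding sum_distrib_left[symmetric] by (intro mult_left_mono C1 C0)
    finally show ?thesis .
  qed
  show ?thesis
  \<comment> \<open>The first factor comes from the third and second differences of the eigenvalues,
    the second is the cube of the uniform bound \<open>sum_w\<close> for the weighted coefficients
    of \<open>V\<close>; neither involves \<open>N\<close> or the time step.\<close>
  proof (intro exI[of _ "(C3 + 2 * C2\<^sup>2) * (C0 * C1) ^ 3"] allI impI)
    fix N :: nat and \<delta> :: real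
    assume N: "N \<ge> 1" and \<delta>: "1 / real N \<le> \<delta>"
    interpret periodic_grid pos N by unfold_locales (use assms N in auto)
    let ?A = "discA CARD('d) a b N" and ?B = "discB pos V a b N"
    have B: "evolved_mult (b - a) (w N) 0 ?B" unfolding w_def by (rule discB_evolved_mult)
    have "op_norm (commutator (commutator ?B (conj_evol ?A ?B t)) (conj_evol ?A ?B s))
        \<le> (C3 + 2 * C2\<^sup>2) * (C0 * C1) ^ 3 * \<delta>\<^sup>2" if "s \<in> {-\<delta>..\<delta>}" "t \<in> {-\<delta>..\<delta>}" for s t
      using that
      by (intro op_norm_double_commutator_le[OF B conj_evol_evolved_mult[OF B] conj_evol_evolved_mult[OF B]
            _ _ \<delta> C2_def C3_def sum_w[OF N]]) auto
    then show "let A = ?A; B = ?B in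
      (SUP (s, \<tau>) \<in> {-\<delta>..\<delta>} \<times> {-\<delta>..\<delta>}.
         ereal (op_norm (commutator (commutator B (conj_evol A B \<tau>)) (conj_evol A B s))))
      \<le> ereal ((C3 + 2 * C2\<^sup>2) * (C0 * C1) ^ 3 * \<delta>\<^sup>2)"
      by (auto simp: Let_def intro!: SUP_least)
  qed
qed

end
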